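(* Let $\Gamma$ be the hexagonal (honeycomb) lattice graph, $\Gamma_0$ its edge graph, with hexagons $H_{[j,k]}$ and functions $\psi_{H_{[j,k]}}$, $[j,k]\in\mathbb Z^2$, as in the context. Let $E_6$ be the space of $u\in\ell^2(\Gamma_0)$ with $-\Delta_{\Gamma_0}u=6u$, and let $\tilde P_6$ be the orthogonal projection of $\ell^2(\Gamma_0)$ onto $E_6$. Let $$\tilde f([j,k])=\int_0^1\!\!\int_0^1\frac{e^{2\pi i(aj+bk)}}{\sqrt{2\left(3-\cos(2\pi a)-\cos(2\pi b)-\cos(2\pi(a-b))\right)}}\,da\,db ,$$ and $\tau_{p,q}\tilde f([j,k])=\tilde f([j+p,k+q])$. Then the functions $\sum_{[j,k]\in\mathbb Z^2}\tau_{p,q}\tilde f([j,k])\,\psi_{H_{[j,k]}}$, $[p,q]\in\mathbb Z^2$, form an orthonormal basis of $E_6$, and $$\tilde P_6F(x)=\sum_{[p,q]\in\mathbb Z^2}\Bigl(\sum_{y\in\Gamma_0}\sum_{[j,k]\in\mathbb Z^2}\tau_{p,q}\tilde f([j,k])\psi_{H_{[j,k]}}(y)F(y)\Bigr)\sum_{[j',k']\in\mathbb Z^2}\tau_{p,q}\tilde f([j',k'])\,\psi_{H_{[j',k']}}(x)$$ for $F\in\ell^2(\Gamma_0)$.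
   Context: The edge graph $\Gamma_0$ has the edges of $\Gamma$ as vertices, two being adjacent iff they share an endpoint ($4$-regular; the kagome lattice). $\Delta_{\Gamma_0}u(x)=\sum_{y\sim x}(u(y)-u(x))$. The hexagons of $\Gamma_0$ (the $6$-cycles formed by the edges of the hexagonal faces of $\Gamma$) are indexed by their centers in the triangular lattice, $H_{[j,k]}$ having center $j(1,0)+k(\frac12,\frac{\sqrt3}2)$, $[j,k]\in\mathbb Z^2$. Each vertex of $\Gamma_0$ lies in exactly two hexagons, and two hexagons share a vertex iff they are neighbors, i.e. their indices differ by one of $\pm[1,0],\pm[0,1],\pm[1,-1]$. $\psi_{H_{[0,0]}}$ takes alternating values $\pm1$ around the six vertices of $H_{[0,0]}$ and vanishes elsewhere, and $\psi_{H_{[j,k]}}$ is its lattice translate supported on $H_{[j,k]}$ (so at a common vertex of two hexagons the two functions have opposite signs). At each vertex the sums over $[j,k]$ have at most two nonzero terms. *)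

theory Defs
  imports "HOL-Analysis.Analysis"
begin

text \<open>
  The hexagonal faces of the honeycomb graph are centred at the points
  \<open>j (1,0) + k (1/2, sqrt 3 / 2)\<close> of the triangular lattice, and its vertices are the
  centroids of the lattice triangles: \<open>Up j k\<close> is the centroid of the triangle with corners
  \<open>[j,k], [j+1,k], [j,k+1]\<close>, and \<open>Down j k\<close> that of \<open>[j+1,k], [j,k+1], [j+1,k+1]\<close>.
  Two vertices are joined iff their triangles share a side.
\<close>

datatype hex_vertex = Up int int | Down int int

definition honeycomb_edges :: "hex_vertex set set" where
  "honeycomb_edges =
     (\<Union>j k. {{Up j k, Down j k}, {Up j k, Down (j - 1) k}, {Up j k, Down j (k - 1)}})"

abbreviation edge_graph :: "hex_vertex set set" ("\<Gamma>\<^sub>0") where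
  "\<Gamma>\<^sub>0 \<equiv> honeycomb_edges"

definition edge_adj :: "hex_vertex set \<Rightarrow> hex_vertex set \<Rightarrow> bool" where
  "edge_adj x y \<longleftrightarrow> x \<in> \<Gamma>\<^sub>0 \<and> y \<in> \<Gamma>\<^sub>0 \<and> x \<noteq> y \<and> x \<inter> y \<noteq> {}"

definition laplacian :: "(hex_vertex set \<Rightarrow> complex) \<Rightarrow> hex_vertex set \<Rightarrow> complex" where
  "laplacian u x = (\<Sum>y | edge_adj x y. u y - u x)"

text \<open>The corners of the hexagonal face with centre \<open>[j,k]\<close> are the centroids of the six
  triangles having \<open>[j,k]\<close> as a corner.\<close>

fun face_corners :: "int \<times> int \<Rightarrow> hex_vertex set" where
  "face_corners (j, k) =
     {Up j k, Up (j - 1) k, Up j (k - 1), Down (j - 1) k, Down j (k - 1), Down (j - 1) (k - 1)}"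

definition hexagon :: "int \<times> int \<Rightarrow> hex_vertex set set" where
  "hexagon c = {e \<in> \<Gamma>\<^sub>0. e \<subseteq> face_corners c}"

text \<open>There are exactly two such functions, differing by a sign. Within a hexagon, adjacency in
  the edge graph is adjacency along the 6-cycle.\<close>

definition alternating_on_hexagon :: "int \<times> int \<Rightarrow> (hex_vertex set \<Rightarrow> complex) \<Rightarrow> bool" where
  "alternating_on_hexagon c g \<longleftrightarrow>
     (\<forall>x\<in>hexagon c. g x = 1 \<or> g x = -1) \<and>
     (\<forall>x\<in>hexagon c. \<forall>y\<in>hexagon c. edge_adj x y \<longrightarrow> g y = - g x) \<and>
     (\<forall>x. x \<notin> hexagon c \<longrightarrow> g x = 0)"

fun shift :: "int \<times> int \<Rightarrow> hex_vertex \<Rightarrow> hex_vertex" where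
  "shift (j, k) (Up a b) = Up (a + j) (b + k)"
| "shift (j, k) (Down a b) = Down (a + j) (b + k)"

fun lattice_translate ::
  "(hex_vertex set \<Rightarrow> complex) \<Rightarrow> int \<times> int \<Rightarrow> hex_vertex set \<Rightarrow> complex" where
  "lattice_translate g (j, k) x = g (shift (- j, - k) ` x)"

text \<open>Functions on \<open>V\<close> are represented by functions vanishing outside \<open>V\<close>, so that equality of
  functions on \<open>V\<close> is equality.\<close>

definition ell2 :: "'a set \<Rightarrow> ('a \<Rightarrow> complex) set" where
  "ell2 V = {u. (\<lambda>x. (cmod (u x))\<^sup>2) summable_on V \<and> (\<forall>x. x \<notin> V \<longrightarrow> u x = 0)}"

definition ell2_inner :: "'a set \<Rightarrow> ('a \<Rightarrow> complex) \<Rightarrow> ('a \<Rightarrow> complex) \<Rightarrow> complex" where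
  "ell2_inner V u v = (\<Sum>\<^sub>\<infinity>x\<in>V. u x * cnj (v x))"

definition ell2_norm :: "'a set \<Rightarrow> ('a \<Rightarrow> complex) \<Rightarrow> real" where
  "ell2_norm V u = sqrt (\<Sum>\<^sub>\<infinity>x\<in>V. (cmod (u x))\<^sup>2)"

definition ell2_orthonormal_basis ::
  "'a set \<Rightarrow> ('a \<Rightarrow> complex) set \<Rightarrow> ('i \<Rightarrow> 'a \<Rightarrow> complex) \<Rightarrow> bool" where
  "ell2_orthonormal_basis V E e \<longleftrightarrow>
     (\<forall>i. e i \<in> E) \<and>
     (\<forall>i i'. ell2_inner V (e i) (e i') = (if i = i' then 1 else 0)) \<and>
     (\<forall>u\<in>E. \<forall>\<epsilon>>0. \<exists>S c. finite S \<and> ell2_norm V (\<lambda>x. u x - (\<Sum>i\<in>S. c i * e i x)) < \<epsilon>)"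

definition ell2_proj :: "'a set \<Rightarrow> ('a \<Rightarrow> complex) set \<Rightarrow> ('a \<Rightarrow> complex) \<Rightarrow> 'a \<Rightarrow> complex" where
  "ell2_proj V E F = (THE u. u \<in> E \<and> (\<forall>v\<in>E. ell2_inner V (\<lambda>x. F x - u x) v = 0))"

definition E6 :: "(hex_vertex set \<Rightarrow> complex) set" where
  "E6 = {u \<in> ell2 \<Gamma>\<^sub>0. \<forall>x\<in>\<Gamma>\<^sub>0. - laplacian u x = 6 * u x}"

text \<open>The integrand is singular only at the corners of the unit square (an integrable
  singularity), where division by zero gives the value \<open>0\<close>.\<close>

fun f_tilde :: "int \<times> int \<Rightarrow> complex" where
  "f_tilde (j, k) =
     (LBINT b:{0..1}. (LBINT a:{0..1}.
        exp (2 * complex_of_real pi * \<i> * complex_of_real (a * real_of_int j + b * real_of_int k)) /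
        complex_of_real (sqrt (2 * (3 - cos (2 * pi * a) - cos (2 * pi * b) - cos (2 * pi * (a - b)))))))"

fun tau :: "int \<times> int \<Rightarrow> (int \<times> int \<Rightarrow> complex) \<Rightarrow> int \<times> int \<Rightarrow> complex" where
  "tau (p, q) f (j, k) = f (j + p, k + q)"

end

theory Submission
  imports Defs
begin

text \<open>
  Write \<open>P\<close> for the transition operator of simple random walk on the triangular lattice of hexagons,
  and \<open>\<Psi> \<phi> = \<Sum>m. \<phi> m \<cdot> \<psi> m\<close> for the synthesis operator (called \<open>curl\<close> below, since its value at an edge
  is the difference of \<open>\<phi>\<close> across that edge). The Gram operator of the functions \<open>\<psi> m\<close> is
  \<open>\<Psi>\<^sup>* \<Psi> = 6 (1 - P)\<close>, and \<open>f_tilde\<close> is the kernel of \<open>(6 (1 - P))\<^sup>-\<^sup>1\<^sup>/\<^sup>2\<close>. The functions in the theorem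
  are therefore the images of the point masses under \<open>\<Psi> (\<Psi>\<^sup>* \<Psi>)\<^sup>-\<^sup>1\<^sup>/\<^sup>2\<close>, the isometric factor in the
  polar decomposition of \<open>\<Psi>\<close>. They are orthonormal, and they span \<open>E6\<close> because no nonzero element of
  \<open>E6\<close> is orthogonal to all \<open>\<psi> m\<close>.

  The inverse root is unbounded: \<open>f_tilde m\<close> decays only like \<open>1 / \<bar>m\<bar>\<close> and is not square summable,
  so \<open>\<Psi> f_tilde\<close> cannot be treated as the image of an \<open>\<ell>\<^sup>2\<close> function. Instead everything is
  expanded in powers of \<open>P\<close>, with the coefficients of \<open>1 / sqrt (1 - x)\<close>. Expanding the integrand of
  \<open>f_tilde\<close> in powers of the Fourier symbol of \<open>P\<close> and integrating term by term gives
  \<open>sqrt 6 \<cdot> f_tilde m = \<Sum>n. inv_sqrt_coeff n \<cdot> walk n m\<close>, where \<open>walk n\<close> is the \<open>n\<close>-step transition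
  kernel (\<open>f_tilde_walk_series\<close>). All terms of this series are nonnegative, so its convergence is
  absolute, and the identity \<open>(1 - x)\<^sup>-\<^sup>1\<^sup>/\<^sup>2 (1 - x)\<^sup>1\<^sup>/\<^sup>2 = 1\<close> of power series may be evaluated on the
  sequence \<open>n \<mapsto> walk n m\<close> (\<open>coeff_has_sum\<close>). This identity yields orthonormality directly. It also
  exhibits each \<open>\<psi> m\<close> as a limit of combinations of the basis functions, whose norms stay bounded
  (\<open>basis_total\<close>). The limits needed are weak ones, obtained from pointwise convergence and a
  uniform bound on the norms (\<open>ell2_weak_limit\<close>, \<open>partial_basis_norm_le_1\<close>).

  Finally, the eigenvalue equation forces the values of \<open>v \<in> E6\<close> at the three edges of every
  honeycomb vertex to add up to zero (\<open>E6_vertex_sums\<close>). If \<open>v\<close> is also orthogonal to every \<open>\<psi> m\<close>,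
  its restriction to one of the three classes of parallel edges is harmonic on the triangular
  lattice, and a harmonic function vanishing at infinity is zero (\<open>E6_orthogonal_psi\<close>). The
  projection formula is the expansion of \<open>F\<close> in an orthonormal basis (\<open>basis_and_projection\<close>).
\<close>

section \<open>Square-summable functions\<close>

lemma ell2_outside: "u \<in> ell2 V \<Longrightarrow> x \<notin> V \<Longrightarrow> u x = 0"
  by (simp add: ell2_def)

lemma ell2_norm_nonneg: "0 \<le> ell2_norm V u"
  unfolding ell2_norm_def by (simp add: infsum_nonneg)

lemma ell2_norm_squared: "(ell2_norm V u)\<^sup>2 = (\<Sum>\<^sub>\<infinity>x\<in>V. (cmod (u x))\<^sup>2)"
  unfolding ell2_norm_def by (simp add: infsum_nonneg)

lemma L2_set_le_ell2_norm:
  assumes "u \<in> ell2 V" "finite A" "A \<subseteq> V"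
  shows "L2_set (\<lambda>x. cmod (u x)) A \<le> ell2_norm V u"
  unfolding L2_set_def ell2_norm_def
  using assms by (intro real_sqrt_le_mono finite_sum_le_infsum) (auto simp: ell2_def)

lemma ell2_bounded_L2_set:
  assumes bound: "\<And>A. finite A \<Longrightarrow> A \<subseteq> V \<Longrightarrow> L2_set (\<lambda>x. cmod (u x)) A \<le> C"
    and outside: "\<And>x. x \<notin> V \<Longrightarrow> u x = 0"
  shows "u \<in> ell2 V" and "ell2_norm V u \<le> C"
proof -
  have C: "0 \<le> C" using bound[of "{}"] by simp
  have b: "(\<Sum>x\<in>A. (cmod (u x))\<^sup>2) \<le> C\<^sup>2" if "finite A" "A \<subseteq> V" for A
    using bound[OF that] C unfolding L2_set_def
    by (simp add: real_sqrt_le_iff sqrt_le_D)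
  have s: "(\<lambda>x. (cmod (u x))\<^sup>2) summable_on V"
    by (rule nonneg_bdd_above_summable_on) (auto intro!: bdd_aboveI2[where M="C\<^sup>2"] b)
  then show "u \<in> ell2 V" using outside by (simp add: ell2_def)
  have "(\<Sum>\<^sub>\<infinity>x\<in>V. (cmod (u x))\<^sup>2) \<le> C\<^sup>2"
    by (rule infsum_le_finite_sums[OF s b])
  then show "ell2_norm V u \<le> C"
    unfolding ell2_norm_def using C by (simp add: real_le_lsqrt infsum_nonneg)
qed

lemma
  assumes "u \<in> ell2 V" "v \<in> ell2 V"
  shows ell2_add: "(\<lambda>x. u x + v x) \<in> ell2 V"
    and ell2_norm_triangle: "ell2_norm V (\<lambda>x. u x + v x) \<le> ell2_norm V u + ell2_norm V v"
proof -
  have b: "L2_set (\<lambda>x. cmod (u x + v x)) A \<le> ell2_norm V u + ell2_norm V v"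
    if "finite A" "A \<subseteq> V" for A
  proof -
    have "L2_set (\<lambda>x. cmod (u x + v x)) A \<le> L2_set (\<lambda>x. cmod (u x) + cmod (v x)) A"
      by (rule L2_set_mono) (auto intro: norm_triangle_ineq)
    also have "\<dots> \<le> L2_set (\<lambda>x. cmod (u x)) A + L2_set (\<lambda>x. cmod (v x)) A"
      by (rule L2_set_triangle_ineq)
    also have "\<dots> \<le> ell2_norm V u + ell2_norm V v"
      using assms that by (intro add_mono L2_set_le_ell2_norm)
    finally show ?thesis .
  qed
  show "(\<lambda>x. u x + v x) \<in> ell2 V"
    by (rule ell2_bounded_L2_set(1)[OF b]) (use assms in \<open>auto simp: ell2_def\<close>)
  show "ell2_norm V (\<lambda>x. u x + v x) \<le> ell2_norm V u + ell2_norm V v"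
    by (rule ell2_bounded_L2_set(2)[OF b]) (use assms in \<open>auto simp: ell2_def\<close>)
qed

lemma
  assumes "u \<in> ell2 V"
  shows ell2_scale: "(\<lambda>x. c * u x) \<in> ell2 V"
    and ell2_norm_scale_le: "ell2_norm V (\<lambda>x. c * u x) \<le> cmod c * ell2_norm V u"
proof -
  have b: "L2_set (\<lambda>x. cmod (c * u x)) A \<le> cmod c * ell2_norm V u"
    if "finite A" "A \<subseteq> V" for A
  proof -
    have "L2_set (\<lambda>x. cmod (c * u x)) A = cmod c * L2_set (\<lambda>x. cmod (u x)) A"
      by (simp add: norm_mult L2_set_right_distrib)
    then show ?thesis
      using L2_set_le_ell2_norm[OF assms that] by (simp add: mult_left_mono)
  qed
  show "(\<lambda>x. c * u x) \<in> ell2 V"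
    by (rule ell2_bounded_L2_set(1)[OF b]) (use assms in \<open>auto simp: ell2_def\<close>)
  show "ell2_norm V (\<lambda>x. c * u x) \<le> cmod c * ell2_norm V u"
    by (rule ell2_bounded_L2_set(2)[OF b]) (use assms in \<open>auto simp: ell2_def\<close>)
qed

lemma ell2_zero: "(\<lambda>x. 0) \<in> ell2 V"
  by (simp add: ell2_def)

lemma ell2_norm_zero: "ell2_norm V (\<lambda>x. 0) = 0"
  by (simp add: ell2_norm_def)

lemma ell2_diff: "u \<in> ell2 V \<Longrightarrow> v \<in> ell2 V \<Longrightarrow> (\<lambda>x. u x - v x) \<in> ell2 V"
  using ell2_add[OF _ ell2_scale, of u V v "-1"] by simp

lemma ell2_sum:
  assumes "finite S" "\<And>i. i \<in> S \<Longrightarrow> w i \<in> ell2 V"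
  shows "(\<lambda>x. \<Sum>i\<in>S. c i * w i x) \<in> ell2 V \<and>
         ell2_norm V (\<lambda>x. \<Sum>i\<in>S. c i * w i x) \<le> (\<Sum>i\<in>S. cmod (c i) * ell2_norm V (w i))"
  using assms
proof (induction S rule: finite_induct)
  case empty
  then show ?case by (simp add: ell2_zero ell2_norm_zero)
next
  case (insert i S)
  let ?r = "\<lambda>x. \<Sum>i\<in>S. c i * w i x"
  have r: "?r \<in> ell2 V" "ell2_norm V ?r \<le> (\<Sum>i\<in>S. cmod (c i) * ell2_norm V (w i))"
    using insert by auto
  have wi: "w i \<in> ell2 V" using insert by auto
  show ?case
    using insert.hyps ell2_add[OF ell2_scale[OF wi] r(1), of "c i"] r(2)
      ell2_norm_triangle[OF ell2_scale[OF wi] r(1), of "c i"] ell2_norm_scale_le[OF wi, of "c i"]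
    by simp
qed

lemma
  assumes "u \<in> ell2 V" "v \<in> ell2 V"
  shows ell2_inner_abs_summable: "(\<lambda>x. cmod (u x * cnj (v x))) summable_on V"
    and ell2_Cauchy_Schwarz: "cmod (ell2_inner V u v) \<le> ell2_norm V u * ell2_norm V v"
proof -
  have b: "(\<Sum>x\<in>A. cmod (u x * cnj (v x))) \<le> ell2_norm V u * ell2_norm V v"
    if "finite A" "A \<subseteq> V" for A
  proof -
    have "(\<Sum>x\<in>A. cmod (u x * cnj (v x))) = (\<Sum>x\<in>A. \<bar>cmod (u x)\<bar> * \<bar>cmod (v x)\<bar>)"
      by (simp add: norm_mult)
    also have "\<dots> \<le> L2_set (\<lambda>x. cmod (u x)) A * L2_set (\<lambda>x. cmod (v x)) A"
      by (rule L2_set_mult_ineq)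
    also have "\<dots> \<le> ell2_norm V u * ell2_norm V v"
      using assms that by (intro mult_mono L2_set_le_ell2_norm) (auto simp: ell2_norm_nonneg)
    finally show ?thesis .
  qed
  show s: "(\<lambda>x. cmod (u x * cnj (v x))) summable_on V"
    by (rule nonneg_bdd_above_summable_on)
       (auto intro!: bdd_aboveI2[where M="ell2_norm V u * ell2_norm V v"] b)
  have "cmod (ell2_inner V u v) \<le> (\<Sum>\<^sub>\<infinity>x\<in>V. cmod (u x * cnj (v x)))"
    unfolding ell2_inner_def by (rule norm_infsum_bound[OF s])
  also have "\<dots> \<le> ell2_norm V u * ell2_norm V v"
    by (rule infsum_le_finite_sums[OF s b])
  finally show "cmod (ell2_inner V u v) \<le> ell2_norm V u * ell2_norm V v" .
qed

lemmas ell2_inner_summable = abs_summable_summable[OF ell2_inner_abs_summable]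

lemma ell2_inner_add_left:
  assumes "u \<in> ell2 V" "u' \<in> ell2 V" "v \<in> ell2 V"
  shows "ell2_inner V (\<lambda>x. u x + u' x) v = ell2_inner V u v + ell2_inner V u' v"
  unfolding ell2_inner_def distrib_right
  by (intro infsum_add ell2_inner_summable assms)

lemma ell2_inner_scale_left: "ell2_inner V (\<lambda>x. c * u x) v = c * ell2_inner V u v"
  unfolding ell2_inner_def by (simp add: mult.assoc infsum_cmult_right')

lemma ell2_inner_commute: "ell2_inner V u v = cnj (ell2_inner V v u)"
  unfolding ell2_inner_def by (subst infsum_cnj[symmetric]) (simp add: mult.commute)

lemma ell2_inner_zero_left: "ell2_inner V (\<lambda>x. 0) v = 0"
  by (simp add: ell2_inner_def)

lemma ell2_inner_diff_left:
  assumes "u \<in> ell2 V" "u' \<in> ell2 V" "v \<in> ell2 V"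
  shows "ell2_inner V (\<lambda>x. u x - u' x) v = ell2_inner V u v - ell2_inner V u' v"
  using ell2_inner_add_left[OF assms(1) ell2_scale[OF assms(2), of "-1"] assms(3)]
    ell2_inner_scale_left[of V "-1" u' v] by simp

lemma ell2_inner_sum_left:
  assumes "finite S" "\<And>i. i \<in> S \<Longrightarrow> w i \<in> ell2 V" "v \<in> ell2 V"
  shows "ell2_inner V (\<lambda>x. \<Sum>i\<in>S. c i * w i x) v = (\<Sum>i\<in>S. c i * ell2_inner V (w i) v)"
  using assms
proof (induction S rule: finite_induct)
  case empty
  then show ?case by (simp add: ell2_inner_zero_left)
next
  case (insert i S)
  have r: "(\<lambda>x. \<Sum>i\<in>S. c i * w i x) \<in> ell2 V" using ell2_sum[of S w V c] insert by auto
  show ?case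
    using insert ell2_inner_add_left[OF ell2_scale[of "w i" V "c i"] r, of v]
    by (simp add: ell2_inner_scale_left)
qed

lemma ell2_inner_sum_right:
  assumes "finite S" "\<And>i. i \<in> S \<Longrightarrow> w i \<in> ell2 V" "v \<in> ell2 V"
  shows "ell2_inner V v (\<lambda>x. \<Sum>i\<in>S. c i * w i x) = (\<Sum>i\<in>S. cnj (c i) * ell2_inner V v (w i))"
proof -
  have "ell2_inner V v (\<lambda>x. \<Sum>i\<in>S. c i * w i x) = cnj (\<Sum>i\<in>S. c i * ell2_inner V (w i) v)"
    by (subst ell2_inner_commute, subst ell2_inner_sum_left) (auto simp: assms)
  also have "\<dots> = (\<Sum>i\<in>S. cnj (c i) * cnj (ell2_inner V (w i) v))" by simp
  finally show ?thesis using ell2_inner_commute[of V v] by simp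
qed

lemma ell2_inner_self:
  assumes "u \<in> ell2 V"
  shows "ell2_inner V u u = of_real ((ell2_norm V u)\<^sup>2)"
proof -
  have "(\<lambda>x. (cmod (u x))\<^sup>2) summable_on V" using assms by (simp add: ell2_def)
  from has_sum_of_real[OF has_sum_infsum[OF this], where 'a=complex]
  show ?thesis
    unfolding ell2_inner_def ell2_norm_squared complex_norm_square[symmetric]
    by (rule infsumI)
qed

lemma ell2_norm_eq_0:
  assumes "u \<in> ell2 V" "ell2_norm V u = 0"
  shows "u = (\<lambda>x. 0)"
proof
  fix x
  show "u x = 0"
  proof (cases "x \<in> V")
    case True
    then show ?thesis using L2_set_le_ell2_norm[OF assms(1), of "{x}"] assms(2) by simp
  qed (use assms in \<open>simp add: ell2_def\<close>)
qed

text \<open>Fatou's lemma in \<open>\<ell>\<^sup>2\<close>: each finite part of the norm passes to the limit. It is stated for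
  filters because the limits below run both along sequences and along finite index sets.\<close>

lemma
  assumes F: "F \<noteq> bot"
    and bound: "\<forall>\<^sub>F i in F. u i \<in> ell2 V \<and> ell2_norm V (u i) \<le> C"
    and lim: "\<And>x. ((\<lambda>i. u i x) \<longlongrightarrow> w x) F"
  shows ell2_pointwise_limit: "w \<in> ell2 V"
    and ell2_norm_pointwise_limit: "ell2_norm V w \<le> C"
proof -
  have b: "L2_set (\<lambda>x. cmod (w x)) A \<le> C" if A: "finite A" "A \<subseteq> V" for A
  proof (rule tendsto_upperbound[OF _ _ F])
    show "((\<lambda>i. L2_set (\<lambda>x. cmod (u i x)) A) \<longlongrightarrow> L2_set (\<lambda>x. cmod (w x)) A) F"
      unfolding L2_set_def by (intro tendsto_intros lim)
    show "\<forall>\<^sub>F i in F. L2_set (\<lambda>x. cmod (u i x)) A \<le> C"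
      using bound by eventually_elim (rule order_trans[OF L2_set_le_ell2_norm[OF _ A]], auto)
  qed
  have o: "w x = 0" if "x \<notin> V" for x
  proof (rule tendsto_unique[OF F lim])
    show "((\<lambda>i. u i x) \<longlongrightarrow> 0) F"
      by (rule tendsto_eventually)
         (use bound that in \<open>auto elim!: eventually_mono simp: ell2_outside\<close>)
  qed
  show "w \<in> ell2 V" "ell2_norm V w \<le> C"
    using ell2_bounded_L2_set[of V w C] b o by auto
qed

lemma ell2_small_tail:
  assumes "v \<in> ell2 V" "\<epsilon> > 0"
  obtains A where "finite A" "A \<subseteq> V" "(\<lambda>x. if x \<in> A then 0 else v x) \<in> ell2 V"
    "ell2_norm V (\<lambda>x. if x \<in> A then 0 else v x) < \<epsilon>"
proof -
  let ?f = "\<lambda>x. (cmod (v x))\<^sup>2"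
  have s: "?f summable_on V" using assms by (simp add: ell2_def)
  obtain A where A: "finite A" "A \<subseteq> V" "dist (sum ?f A) (infsum ?f V) \<le> (\<epsilon>/2)\<^sup>2"
    using infsum_finite_approximation[OF s, of "(\<epsilon>/2)\<^sup>2"] assms(2) by auto
  let ?v = "\<lambda>x. if x \<in> A then 0 else v x"
  have s': "?f summable_on (V - A)" by (rule summable_on_subset_banach[OF s]) auto
  have eq: "infsum ?f V = sum ?f A + infsum ?f (V - A)"
    using infsum_Un_disjoint[of ?f A "V - A"] s' A by (simp add: Un_absorb1)
  have n: "(\<Sum>\<^sub>\<infinity>x\<in>V. (cmod (?v x))\<^sup>2) = infsum ?f (V - A)"
    by (rule infsum_cong_neutral) auto
  have "(\<lambda>x. (cmod (?v x))\<^sup>2) summable_on V"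
    using s' by (subst summable_on_cong_neutral[where T="V - A" and g="?f"]) auto
  then have v: "?v \<in> ell2 V" using assms by (simp add: ell2_def)
  have "infsum ?f (V - A) \<le> (\<epsilon>/2)\<^sup>2"
    using A(3) infsum_nonneg[of "V-A" ?f] unfolding eq dist_real_def by auto
  then have "ell2_norm V ?v \<le> \<epsilon>/2"
    unfolding ell2_norm_def n using assms(2) by (intro real_le_lsqrt) (auto intro: infsum_nonneg)
  then show ?thesis using that[OF A(1,2) v] assms(2) by simp
qed

text \<open>Up to a small error in norm the test function \<open>v\<close> is supported on a finite set. There
  pointwise convergence is enough, and the norm bound controls the rest.\<close>

lemma ell2_weak_limit:
  assumes bound: "\<forall>\<^sub>F i in F. u i \<in> ell2 V \<and> ell2_norm V (u i) \<le> C"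
    and lim: "\<And>x. ((\<lambda>i. u i x) \<longlongrightarrow> w x) F"
    and w: "w \<in> ell2 V" and v: "v \<in> ell2 V"
  shows "((\<lambda>i. ell2_inner V (u i) v) \<longlongrightarrow> ell2_inner V w v) F"
proof (rule tendstoI)
  fix \<epsilon> :: real assume \<epsilon>: "\<epsilon> > 0"
  define D where "D = \<bar>C\<bar> + ell2_norm V w + 1"
  have D: "D > 0" unfolding D_def using ell2_norm_nonneg[of V w] by linarith
  obtain A where A: "finite A" "A \<subseteq> V" and vt: "(\<lambda>x. if x \<in> A then 0 else v x) \<in> ell2 V"
    and small: "ell2_norm V (\<lambda>x. if x \<in> A then 0 else v x) < \<epsilon> / (2 * D)"
    by (rule ell2_small_tail[OF v, of "\<epsilon> / (2 * D)"]) (use \<epsilon> D in auto)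
  let ?vt = "\<lambda>x. if x \<in> A then 0 else v x"
  have "((\<lambda>i. \<Sum>x\<in>A. (u i x - w x) * cnj (v x)) \<longlongrightarrow> (\<Sum>x\<in>A. (w x - w x) * cnj (v x))) F"
    by (intro tendsto_intros lim)
  then have "\<forall>\<^sub>F i in F. cmod (\<Sum>x\<in>A. (u i x - w x) * cnj (v x)) < \<epsilon> / 2"
    using tendstoD[of "\<lambda>i. \<Sum>x\<in>A. (u i x - w x) * cnj (v x)" 0 F "\<epsilon>/2"] \<epsilon> by simp
  with bound show "\<forall>\<^sub>F i in F. dist (ell2_inner V (u i) v) (ell2_inner V w v) < \<epsilon>"
  proof eventually_elim
    case (elim i)
    let ?r = "\<lambda>x. u i x - w x"
    have r: "?r \<in> ell2 V" using elim w by (blast intro: ell2_diff)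
    have "ell2_norm V ?r \<le> ell2_norm V (u i) + ell2_norm V w"
      using ell2_norm_triangle[of "u i" V "\<lambda>x. -1 * w x"] elim w ell2_scale[OF w, of "-1"]
        ell2_norm_scale_le[OF w, of "-1"] by simp
    also have "\<dots> \<le> D" using elim unfolding D_def by linarith
    finally have rD: "ell2_norm V ?r \<le> D" .
    have "ell2_inner V ?r v = (\<Sum>\<^sub>\<infinity>x\<in>V. (if x \<in> A then ?r x * cnj (v x) else 0) + ?r x * cnj (?vt x))"
      unfolding ell2_inner_def by (rule infsum_cong) auto
    also have "\<dots> = (\<Sum>\<^sub>\<infinity>x\<in>V. if x \<in> A then ?r x * cnj (v x) else 0) + ell2_inner V ?r ?vt"
      unfolding ell2_inner_def
    proof (rule infsum_add[OF _ ell2_inner_summable[OF r vt]])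
      show "(\<lambda>x. if x \<in> A then ?r x * cnj (v x) else 0) summable_on V"
        by (rule finite_nonzero_values_imp_summable_on, rule finite_subset[OF _ A(1)]) auto
    qed
    also have "(\<Sum>\<^sub>\<infinity>x\<in>V. if x \<in> A then ?r x * cnj (v x) else 0) = (\<Sum>x\<in>A. ?r x * cnj (v x))"
      by (rule infsumI, rule has_sum_finite_neutralI[OF A]) auto
    finally have eq: "ell2_inner V ?r v = (\<Sum>x\<in>A. ?r x * cnj (v x)) + ell2_inner V ?r ?vt" .
    have "cmod (ell2_inner V ?r ?vt) \<le> ell2_norm V ?r * ell2_norm V ?vt"
      by (rule ell2_Cauchy_Schwarz[OF r vt])
    also have "\<dots> \<le> D * (\<epsilon> / (2 * D))"
      using rD small D by (intro mult_mono) (auto simp: ell2_norm_nonneg)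
    also have "\<dots> = \<epsilon> / 2" using D by simp
    finally have "cmod (ell2_inner V ?r v) < \<epsilon>"
      unfolding eq using elim norm_triangle_ineq[of "\<Sum>x\<in>A. ?r x * cnj (v x)" "ell2_inner V ?r ?vt"]
      by linarith
    then show ?case
      using ell2_inner_diff_left[of "u i" V w v] elim w v by (simp add: dist_norm)
  qed
qed

section \<open>Orthonormal systems\<close>

locale ell2_orthonormal =
  fixes V :: "'a set" and e :: "'i \<Rightarrow> 'a \<Rightarrow> complex"
  assumes mem: "e i \<in> ell2 V"
    and orthonormal: "ell2_inner V (e i) (e j) = (if i = j then 1 else 0)"
begin

lemma span_mem: "finite S \<Longrightarrow> (\<lambda>x. \<Sum>i\<in>S. c i * e i x) \<in> ell2 V"
  using ell2_sum[of S e V c] mem by blast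

lemma inner_span:
  "finite S \<Longrightarrow> ell2_inner V (\<lambda>x. \<Sum>i\<in>S. c i * e i x) (e j) = (if j \<in> S then c j else 0)"
  by (simp add: ell2_inner_sum_left mem orthonormal if_distrib sum.delta' cong: if_cong)

lemma inner_span_right:
  assumes "finite S" "F \<in> ell2 V"
  shows "ell2_inner V F (\<lambda>x. \<Sum>i\<in>S. c i * e i x) = (\<Sum>i\<in>S. cnj (c i) * ell2_inner V F (e i))"
  using assms by (intro ell2_inner_sum_right mem)

lemma norm_span:
  assumes S: "finite S"
  shows "ell2_norm V (\<lambda>x. \<Sum>i\<in>S. c i * e i x) = L2_set (\<lambda>i. cmod (c i)) S"
proof -
  let ?s = "\<lambda>x. \<Sum>i\<in>S. c i * e i x"
  have "complex_of_real ((ell2_norm V ?s)\<^sup>2) = (\<Sum>i\<in>S. cnj (c i) * c i)"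
    using ell2_inner_self[OF span_mem[OF S, of c]] inner_span_right[OF S span_mem[OF S, of c], of c]
      inner_span[OF S, of c] by simp
  also have "\<dots> = of_real (\<Sum>i\<in>S. (cmod (c i))\<^sup>2)"
    unfolding of_real_sum complex_norm_square by (simp add: mult.commute)
  finally have "(ell2_norm V ?s)\<^sup>2 = (\<Sum>i\<in>S. (cmod (c i))\<^sup>2)" by (simp only: of_real_eq_iff)
  then show ?thesis
    unfolding L2_set_def by (simp add: real_sqrt_unique[symmetric] ell2_norm_nonneg)
qed

lemma Bessel:
  assumes F: "F \<in> ell2 V"
  shows "(\<lambda>i. ell2_inner V F (e i)) \<in> ell2 UNIV"
proof (rule ell2_bounded_L2_set(1)[where C="ell2_norm V F"])
  fix A :: "'i set" assume A: "finite A"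
  let ?c = "\<lambda>i. ell2_inner V F (e i)"
  let ?s = "\<lambda>x. \<Sum>i\<in>A. ?c i * e i x"
  let ?L = "L2_set (\<lambda>i. cmod (?c i)) A"
  have "ell2_inner V F ?s = (\<Sum>i\<in>A. cnj (?c i) * ?c i)" by (rule inner_span_right[OF A F])
  also have "\<dots> = of_real (\<Sum>i\<in>A. (cmod (?c i))\<^sup>2)"
    unfolding of_real_sum complex_norm_square by (simp add: mult.commute)
  also have "(\<Sum>i\<in>A. (cmod (?c i))\<^sup>2) = ?L\<^sup>2"
    unfolding L2_set_def by (simp add: sum_nonneg)
  finally have "cmod (ell2_inner V F ?s) = ?L\<^sup>2" by (simp del: of_real_power)
  then have "?L\<^sup>2 \<le> ell2_norm V F * ?L"
    using ell2_Cauchy_Schwarz[OF F span_mem[OF A, of ?c]] norm_span[OF A, of ?c] by simp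
  then show "?L \<le> ell2_norm V F"
    using L2_set_nonneg[of "\<lambda>i. cmod (?c i)" A] ell2_norm_nonneg[of V F]
    by (cases "?L = 0") (auto simp: power2_eq_square)
qed auto

text \<open>This is Bessel's inequality for the point mass at \<open>x\<close>.\<close>

lemma pointwise_square_summable: "(\<lambda>i. cnj (e i x)) \<in> ell2 UNIV"
proof (cases "x \<in> V")
  case True
  let ?\<delta> = "\<lambda>y. if y = x then 1 else 0 :: complex"
  have "?\<delta> \<in> ell2 V"
    using True by (auto simp: ell2_def intro!: finite_nonzero_values_imp_summable_on)
  moreover have "ell2_inner V ?\<delta> (e i) = cnj (e i x)" for i
    unfolding ell2_inner_def
    by (rule infsumI, rule has_sum_finite_neutralI[of "{x}"]) (use True in auto)
  ultimately show ?thesis using Bessel[of ?\<delta>] by simp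
next
  case False
  then have "e i x = 0" for i using mem[of i] by (rule ell2_outside[rotated])
  then show ?thesis by (simp add: ell2_zero)
qed

text \<open>The Riesz--Fischer theorem. The series converges pointwise because the values of the \<open>e i\<close> at a
  point are square summable. Completeness of \<open>\<ell>\<^sup>2\<close> enters through Fatou's
  lemma, which turns the Cauchy property of the partial sums into norm convergence.\<close>

lemma Riesz_Fischer:
  assumes c: "c \<in> ell2 UNIV"
  obtains w where "w \<in> ell2 V"
    and "\<And>x. ((\<lambda>i. c i * e i x) has_sum w x) UNIV"
    and "\<And>j. ell2_inner V w (e j) = c j"
    and "\<And>\<epsilon>. \<epsilon> > 0 \<Longrightarrow> \<exists>S. finite S \<and> ell2_norm V (\<lambda>x. w x - (\<Sum>i\<in>S. c i * e i x)) < \<epsilon>"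
proof -
  let ?s = "\<lambda>S x. \<Sum>i\<in>S. c i * e i x"
  let ?F = "finite_subsets_at_top (UNIV :: 'i set)"
  define w where "w x = (\<Sum>\<^sub>\<infinity>i. c i * e i x)" for x
  have sum: "((\<lambda>i. c i * e i x) has_sum w x) UNIV" for x
    using ell2_inner_summable[OF c pointwise_square_summable[of x]] by (simp add: w_def)
  then have lim: "((\<lambda>S. ?s S x) \<longlongrightarrow> w x) ?F" for x
    by (simp add: has_sum_def)
  have bound: "\<forall>\<^sub>F S in ?F. ?s S \<in> ell2 V \<and> ell2_norm V (?s S) \<le> ell2_norm UNIV c"
    by (rule eventually_finite_subsets_at_top_weakI)
       (auto simp: span_mem norm_span intro!: L2_set_le_ell2_norm c)
  have w: "w \<in> ell2 V"
    by (rule ell2_pointwise_limit[OF _ bound lim]) simp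
  have coeff: "ell2_inner V w (e j) = c j" for j
  proof (rule tendsto_unique[OF _ ell2_weak_limit[OF bound lim w mem]])
    show "((\<lambda>S. ell2_inner V (?s S) (e j)) \<longlongrightarrow> c j) ?F"
      by (rule tendsto_eventually, unfold eventually_finite_subsets_at_top,
          rule exI[of _ "{j}"]) (auto simp: inner_span)
  qed simp
  have approx: "\<exists>S. finite S \<and> ell2_norm V (\<lambda>x. w x - ?s S x) < \<epsilon>" if \<epsilon>: "\<epsilon> > 0" for \<epsilon>
  proof -
    obtain A where A: "finite A" and t: "(\<lambda>i. if i \<in> A then 0 else c i) \<in> ell2 UNIV"
      and small: "ell2_norm UNIV (\<lambda>i. if i \<in> A then 0 else c i) < \<epsilon>"
      by (rule ell2_small_tail[OF c \<epsilon>])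
    have "ell2_norm V (\<lambda>x. w x - ?s A x) \<le> ell2_norm UNIV (\<lambda>i. if i \<in> A then 0 else c i)"
    proof (rule ell2_norm_pointwise_limit[where F="?F"])
      show "((\<lambda>B. ?s B x - ?s A x) \<longlongrightarrow> w x - ?s A x) ?F" for x
        by (intro tendsto_intros lim)
      have "(\<lambda>x. ?s B x - ?s A x) \<in> ell2 V \<and>
        ell2_norm V (\<lambda>x. ?s B x - ?s A x) \<le> ell2_norm UNIV (\<lambda>i. if i \<in> A then 0 else c i)"
        if B: "finite B" "A \<subseteq> B" for B
      proof -
        have eq: "(\<lambda>x. ?s B x - ?s A x) = ?s (B - A)"
          using B by (simp add: sum_diff)
        have "ell2_norm V (?s (B - A)) = L2_set (\<lambda>i. cmod (c i)) (B - A)"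
          using B by (simp add: norm_span)
        also have "\<dots> = L2_set (\<lambda>i. cmod (if i \<in> A then 0 else c i)) (B - A)"
          by (rule L2_set_cong) auto
        also have "\<dots> \<le> ell2_norm UNIV (\<lambda>i. if i \<in> A then 0 else c i)"
          using B by (intro L2_set_le_ell2_norm t) auto
        finally show ?thesis unfolding eq using B by (simp add: span_mem)
      qed
      then show "\<forall>\<^sub>F B in ?F. (\<lambda>x. ?s B x - ?s A x) \<in> ell2 V \<and>
        ell2_norm V (\<lambda>x. ?s B x - ?s A x) \<le> ell2_norm UNIV (\<lambda>i. if i \<in> A then 0 else c i)"
        unfolding eventually_finite_subsets_at_top using A by blast
    qed simp
    then show ?thesis using A small by (intro exI[of _ A]) auto
  qed
  show thesis by (rule that[OF w sum coeff approx])
qed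

text \<open>An element of \<open>E\<close> minus its expansion lies in \<open>E\<close> and is orthogonal to every \<open>e i\<close>, so it vanishes
  by totality. For arbitrary \<open>F\<close> the same remainder is orthogonal to the closed span of the \<open>e i\<close>,
  which is \<open>E\<close>. Closedness of \<open>E\<close> is formulated with pointwise limits because a local condition, such
  as an eigenvalue equation, passes to them at once.\<close>

theorem basis_and_projection:
  assumes E: "E \<subseteq> ell2 V"
    and diff: "\<And>u v. u \<in> E \<Longrightarrow> v \<in> E \<Longrightarrow> (\<lambda>x. u x - v x) \<in> E"
    and span: "\<And>S c. finite S \<Longrightarrow> (\<lambda>x. \<Sum>i\<in>S. c i * e i x) \<in> E"
    and closed: "\<And>u w. \<lbrakk>\<And>S. finite S \<Longrightarrow> u S \<in> E; w \<in> ell2 V;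
        \<And>x. ((\<lambda>S. u S x) \<longlongrightarrow> w x) (finite_subsets_at_top (UNIV :: 'i set))\<rbrakk> \<Longrightarrow> w \<in> E"
    and total: "\<And>u. u \<in> E \<Longrightarrow> (\<And>i. ell2_inner V u (e i) = 0) \<Longrightarrow> u = (\<lambda>x. 0)"
  shows "ell2_orthonormal_basis V E e"
    and "F \<in> ell2 V \<Longrightarrow> ((\<lambda>i. ell2_inner V F (e i) * e i x) has_sum ell2_proj V E F x) UNIV"
proof -
  have expansion: "\<exists>w\<in>E. (\<forall>x. ((\<lambda>i. ell2_inner V F (e i) * e i x) has_sum w x) UNIV) \<and>
      (\<forall>j. ell2_inner V w (e j) = ell2_inner V F (e j)) \<and>
      (\<forall>\<epsilon>>0. \<exists>S. finite S \<and> ell2_norm V (\<lambda>x. w x - (\<Sum>i\<in>S. ell2_inner V F (e i) * e i x)) < \<epsilon>)"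
    if F: "F \<in> ell2 V" for F
  proof (rule Riesz_Fischer[OF Bessel[OF F]])
    fix w assume w: "w \<in> ell2 V"
      "\<And>x. ((\<lambda>i. ell2_inner V F (e i) * e i x) has_sum w x) UNIV"
      "\<And>j. ell2_inner V w (e j) = ell2_inner V F (e j)"
      "\<And>\<epsilon>. \<epsilon> > 0 \<Longrightarrow> \<exists>S. finite S \<and> ell2_norm V (\<lambda>x. w x - (\<Sum>i\<in>S. ell2_inner V F (e i) * e i x)) < \<epsilon>"
    have "w \<in> E"
      by (rule closed[of "\<lambda>S x. \<Sum>i\<in>S. ell2_inner V F (e i) * e i x", OF span w(1)])
         (use w(2) in \<open>simp_all add: has_sum_def\<close>)
    then show ?thesis using w(2-) by (intro bexI[of _ w] conjI allI impI)
  qed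
  have approx: "\<exists>S c. finite S \<and> ell2_norm V (\<lambda>x. u x - (\<Sum>i\<in>S. c i * e i x)) < \<epsilon>"
    if u: "u \<in> E" and \<epsilon>: "\<epsilon> > 0" for u \<epsilon>
  proof -
    have u2: "u \<in> ell2 V" using u E by blast
    from expansion[OF u2] obtain w where w: "w \<in> E" "\<forall>x. ((\<lambda>i. ell2_inner V u (e i) * e i x) has_sum w x) UNIV"
      "\<forall>j. ell2_inner V w (e j) = ell2_inner V u (e j)"
      "\<forall>\<epsilon>>0. \<exists>S. finite S \<and> ell2_norm V (\<lambda>x. w x - (\<Sum>i\<in>S. ell2_inner V u (e i) * e i x)) < \<epsilon>"
      by (elim bexE conjE)
    have "(\<lambda>x. w x - u x) = (\<lambda>x. 0)"
    proof (rule total[OF diff[OF w(1) u]])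
      show "ell2_inner V (\<lambda>x. w x - u x) (e i) = 0" for i
        using ell2_inner_diff_left[of w V u "e i"] w E u2 mem by auto
    qed
    then have "w = u" by (auto simp: fun_eq_iff)
    then obtain S where "finite S"
      "ell2_norm V (\<lambda>x. u x - (\<Sum>i\<in>S. ell2_inner V u (e i) * e i x)) < \<epsilon>"
      using w(4) \<epsilon> by auto
    then show ?thesis by (intro exI conjI)
  qed
  have "e i \<in> E" for i
    using span[of "{i}" "\<lambda>_. 1"] by simp
  then show "ell2_orthonormal_basis V E e"
    unfolding ell2_orthonormal_basis_def using orthonormal approx by (intro conjI allI ballI impI)
  show "((\<lambda>i. ell2_inner V F (e i) * e i x) has_sum ell2_proj V E F x) UNIV" if F: "F \<in> ell2 V"
  proof -
    from expansion[OF F] obtain w where w: "w \<in> E"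
      "\<forall>x. ((\<lambda>i. ell2_inner V F (e i) * e i x) has_sum w x) UNIV"
      "\<forall>j. ell2_inner V w (e j) = ell2_inner V F (e j)"
      by (elim bexE conjE)
    have w2: "w \<in> ell2 V" using w E by blast
    let ?r = "\<lambda>x. F x - w x"
    have r: "?r \<in> ell2 V" by (rule ell2_diff[OF F w2])
    have re: "ell2_inner V ?r (e j) = 0" for j
      using ell2_inner_diff_left[OF F w2 mem] w(3) by simp
    have orth: "ell2_inner V ?r v = 0" if v: "v \<in> E" for v
    proof (rule ccontr)
      assume n: "ell2_inner V ?r v \<noteq> 0"
      have v2: "v \<in> ell2 V" using v E by blast
      \<comment> \<open>small enough that the Cauchy--Schwarz bound below stays under the inner product itself\<close>
      define \<epsilon> where "\<epsilon> = cmod (ell2_inner V ?r v) / (ell2_norm V ?r + 1)"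
      have \<epsilon>: "\<epsilon> > 0" unfolding \<epsilon>_def using n ell2_norm_nonneg[of V ?r] by simp
      obtain S c where S: "finite S" "ell2_norm V (\<lambda>x. v x - (\<Sum>i\<in>S. c i * e i x)) < \<epsilon>"
        using approx[OF v \<epsilon>] by blast
      let ?s = "\<lambda>x. \<Sum>i\<in>S. c i * e i x"
      have vs: "(\<lambda>x. v x - ?s x) \<in> ell2 V" by (rule ell2_diff[OF v2 span_mem[OF S(1)]])
      have "ell2_inner V (\<lambda>x. v x - ?s x) ?r = ell2_inner V v ?r - ell2_inner V ?s ?r"
        by (rule ell2_inner_diff_left[OF v2 span_mem[OF S(1)] r])
      moreover have "ell2_inner V ?s ?r = 0"
        using inner_span_right[OF S(1) r, of c] re ell2_inner_commute[of V ?s ?r] by simp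
      ultimately have "cmod (ell2_inner V ?r v) = cmod (ell2_inner V (\<lambda>x. v x - ?s x) ?r)"
        using ell2_inner_commute[of V ?r v] by simp
      also have "\<dots> \<le> ell2_norm V (\<lambda>x. v x - ?s x) * ell2_norm V ?r"
        by (rule ell2_Cauchy_Schwarz[OF vs r])
      also have "\<dots> \<le> \<epsilon> * ell2_norm V ?r"
        using S(2) by (intro mult_right_mono) (auto simp: ell2_norm_nonneg)
      also have "\<dots> < \<epsilon> * (ell2_norm V ?r + 1)" using \<epsilon> by simp
      also have "\<dots> = cmod (ell2_inner V ?r v)"
        unfolding \<epsilon>_def using ell2_norm_nonneg[of V ?r] by simp
      finally show False by simp
    qed
    have "ell2_proj V E F = w"
      unfolding ell2_proj_def
    proof (rule the_equality)
      show "w \<in> E \<and> (\<forall>v\<in>E. ell2_inner V ?r v = 0)" using w orth by blast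
      fix u assume u: "u \<in> E \<and> (\<forall>v\<in>E. ell2_inner V (\<lambda>x. F x - u x) v = 0)"
      let ?d = "\<lambda>x. u x - w x"
      have u2: "u \<in> ell2 V" and d: "?d \<in> E" using u E diff w by auto
      have d2: "?d \<in> ell2 V" using d E by blast
      have "ell2_inner V ?d ?d = ell2_inner V (\<lambda>x. ?r x - (F x - u x)) ?d" by simp
      also have "\<dots> = ell2_inner V ?r ?d - ell2_inner V (\<lambda>x. F x - u x) ?d"
        by (rule ell2_inner_diff_left[OF r ell2_diff[OF F u2] d2])
      also have "\<dots> = 0" using orth d u by simp
      finally have "ell2_norm V ?d = 0" using ell2_inner_self[OF d2] by simp
      then show "u = w" using ell2_norm_eq_0[OF d2] by (auto simp: fun_eq_iff)
    qed
    then show ?thesis using w(2) by simp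
  qed
qed

end

section \<open>The coefficients of \<open>1 / sqrt (1 - x)\<close>\<close>

definition inv_sqrt_coeff :: "nat \<Rightarrow> real" where
  "inv_sqrt_coeff n = (-1) ^ n * ((-1/2) gchoose n)"

text \<open>The coefficients of \<open>sqrt (1 - x) = (1 - x) / sqrt (1 - x)\<close>.\<close>

definition sqrt_coeff :: "nat \<Rightarrow> real" where
  "sqrt_coeff n = (if n = 0 then 1 else inv_sqrt_coeff n - inv_sqrt_coeff (n - 1))"

lemma inv_sqrt_coeff_0: "inv_sqrt_coeff 0 = 1"
  by (simp add: inv_sqrt_coeff_def)

lemma inv_sqrt_coeff_Suc: "inv_sqrt_coeff (Suc n) = inv_sqrt_coeff n * ((2 * real n + 1) / (2 * real n + 2))"
proof -
  have "(real n + 1) * ((-1/2) gchoose Suc n) = (-1/2 - real n) * ((-1/2::real) gchoose n)"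
    using gbinomial_absorb_comp[of "-1/2::real" n] gbinomial_absorption'[of "Suc n" "-1/2::real"]
      gbinomial_mult_1[of "-1/2::real" n] by (simp add: algebra_simps)
  then have "((-1/2) gchoose Suc n) = (-1/2 - real n) * ((-1/2::real) gchoose n) / (real n + 1)"
    by (simp add: field_simps)
  then show ?thesis
    unfolding inv_sqrt_coeff_def by (simp only: power_Suc) (simp add: divide_simps, simp add: algebra_simps)
qed

lemma inv_sqrt_coeff_pos: "0 < inv_sqrt_coeff n"
  by (induction n) (simp_all add: inv_sqrt_coeff_0 inv_sqrt_coeff_Suc)

lemma inv_sqrt_coeff_nonneg: "0 \<le> inv_sqrt_coeff n"
  using inv_sqrt_coeff_pos[of n] by simp

lemma inv_sqrt_coeff_Suc_le: "inv_sqrt_coeff (Suc n) \<le> inv_sqrt_coeff n"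
  unfolding inv_sqrt_coeff_Suc using inv_sqrt_coeff_nonneg[of n] by (intro mult_left_le) auto

lemma inv_sqrt_coeff_series:
  assumes "\<bar>x\<bar> < 1"
  shows "(\<lambda>n. inv_sqrt_coeff n * x ^ n) sums (1 / sqrt (1 - x))"
proof -
  have "(\<lambda>n. ((-1/2) gchoose n) * (-x) ^ n) sums (1 + - x) powr (-1/2)"
    using assms by (intro gen_binomial_real) simp
  moreover have "((-1/2) gchoose n) * (-x) ^ n = inv_sqrt_coeff n * x ^ n" for n
    unfolding inv_sqrt_coeff_def by (subst power_minus) simp
  moreover have "(1 + - x) powr (-1/2) = 1 / sqrt (1 - x)"
  proof -
    have "(1 + - x) powr (-1/2) = (1 - x) powr (- (1/2))" by simp
    also have "\<dots> = inverse ((1 - x) powr (1/2))" by (rule powr_minus)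
    also have "\<dots> = 1 / sqrt (1 - x)" using assms by (simp add: powr_half_sqrt inverse_eq_divide)
    finally show ?thesis .
  qed
  ultimately show ?thesis by simp
qed

lemma inv_sqrt_coeff_convolution: "(\<Sum>k\<le>n. inv_sqrt_coeff k * inv_sqrt_coeff (n - k)) = 1"
proof -
  have "(\<Sum>k\<le>n. inv_sqrt_coeff k * inv_sqrt_coeff (n - k)) =
      (-1) ^ n * (\<Sum>k\<le>n. ((-1/2) gchoose k) * ((-1/2::real) gchoose (n - k)))"
    unfolding sum_distrib_left
  proof (rule sum.cong)
    fix k assume "k \<in> {..n}"
    then have "(-1::real) ^ n = (-1) ^ k * (-1) ^ (n - k)" by (simp flip: power_add)
    then show "inv_sqrt_coeff k * inv_sqrt_coeff (n - k) =
        (-1) ^ n * (((-1/2) gchoose k) * ((-1/2::real) gchoose (n - k)))"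
      unfolding inv_sqrt_coeff_def by simp
  qed simp
  also have "\<dots> = (-1) ^ n * ((-1/2 + -1/2::real) gchoose n)"
    using gbinomial_Vandermonde[of "-1/2::real" "-1/2" n] by (simp add: atLeast0AtMost)
  also have "(-1/2 + -1/2::real) = - 1" by simp
  also have "((-1::real) gchoose n) = (-1) ^ n"
    using gbinomial_minus[of "1::real" n] by (simp add: binomial_gbinomial[symmetric])
  finally show ?thesis by (simp flip: power_mult_distrib)
qed

lemma sqrt_coeff_abs: "\<bar>sqrt_coeff k\<bar> = (if k = 0 then 2 else 0) - sqrt_coeff k"
  using inv_sqrt_coeff_Suc_le[of "k - 1"] by (cases k) (auto simp: sqrt_coeff_def)

lemma sqrt_coeff_le_0: "k > 0 \<Longrightarrow> sqrt_coeff k \<le> 0"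
  using inv_sqrt_coeff_Suc_le[of "k - 1"] by (cases k) (auto simp: sqrt_coeff_def)

lemma sqrt_coeff_nonzero: "sqrt_coeff k \<noteq> 0"
proof (cases k)
  case (Suc n)
  have "inv_sqrt_coeff n * ((2 * real n + 1) / (2 * real n + 2)) < inv_sqrt_coeff n * 1"
    using inv_sqrt_coeff_pos[of n] by (intro mult_strict_left_mono) auto
  then show ?thesis using Suc by (simp add: sqrt_coeff_def inv_sqrt_coeff_Suc)
qed (simp add: sqrt_coeff_def)

lemma sum_sqrt_coeff_abs: "(\<Sum>k<n. \<bar>sqrt_coeff k\<bar>) \<le> 2"
proof -
  have "(\<Sum>k<Suc n. \<bar>sqrt_coeff k\<bar>) = 2 - inv_sqrt_coeff n"
    by (induction n) (simp_all add: sqrt_coeff_abs, simp_all add: sqrt_coeff_def inv_sqrt_coeff_0)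
  then show ?thesis using inv_sqrt_coeff_nonneg[of n] abs_ge_zero[of "sqrt_coeff n"] by simp
qed

lemma coeff_convolution: "(\<Sum>k\<le>n. inv_sqrt_coeff (n - k) * sqrt_coeff k) = (if n = 0 then 1 else 0)"
proof (cases n)
  case (Suc m)
  have "(\<Sum>k\<le>n. inv_sqrt_coeff (n - k) * sqrt_coeff k) = inv_sqrt_coeff n + (\<Sum>k\<le>m. inv_sqrt_coeff (m - k) * (inv_sqrt_coeff (Suc k) - inv_sqrt_coeff k))"
    unfolding Suc sum.atMost_Suc_shift by (simp add: sqrt_coeff_def)
  also have "\<dots> = (inv_sqrt_coeff n + (\<Sum>k\<le>m. inv_sqrt_coeff (m - k) * inv_sqrt_coeff (Suc k))) - (\<Sum>k\<le>m. inv_sqrt_coeff (m - k) * inv_sqrt_coeff k)"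
    by (simp add: algebra_simps sum_subtractf)
  also have "inv_sqrt_coeff n + (\<Sum>k\<le>m. inv_sqrt_coeff (m - k) * inv_sqrt_coeff (Suc k)) = (\<Sum>k\<le>n. inv_sqrt_coeff k * inv_sqrt_coeff (n - k))"
    unfolding Suc sum.atMost_Suc_shift by (simp add: inv_sqrt_coeff_0 mult.commute)
  also have "(\<Sum>k\<le>m. inv_sqrt_coeff (m - k) * inv_sqrt_coeff k) = (\<Sum>k\<le>m. inv_sqrt_coeff k * inv_sqrt_coeff (m - k))"
    by (simp add: mult.commute)
  finally show ?thesis using Suc by (simp add: inv_sqrt_coeff_convolution)
qed (simp add: inv_sqrt_coeff_0 sqrt_coeff_def)

lemma inv_sqrt_coeff_summation_by_parts:
  "(\<Sum>k\<le>N. inv_sqrt_coeff k * (a k - a (Suc k))) = (\<Sum>k\<le>N. sqrt_coeff k * a k) - inv_sqrt_coeff N * a (Suc N)"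
  by (induction N) (simp_all add: inv_sqrt_coeff_0 sqrt_coeff_def algebra_simps)

text \<open>For \<open>a n = x ^ n\<close> this says that the partial sums of \<open>1 / sqrt (1 - x)\<close>, squared and multiplied
  by \<open>1 - x\<close>, have no positive coefficient beyond the constant one. Summation by parts in \<open>k\<close> produces the
  weights \<open>inv_sqrt_coeff n * sqrt_coeff k\<close>; the part \<open>n + k \<le> N\<close> of the square collapses by
  \<open>coeff_convolution\<close>, and in the other part \<open>k > 0\<close>, so the weights are nonpositive.\<close>

lemma inv_sqrt_coeff_quadratic_form_le:
  assumes a: "\<And>n. 0 \<le> a n"
  shows "(\<Sum>n\<le>N. \<Sum>k\<le>N. inv_sqrt_coeff n * inv_sqrt_coeff k * (a (n + k) - a (Suc (n + k)))) \<le> a 0"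
proof -
  have "(\<Sum>n\<le>N. \<Sum>k\<le>N. inv_sqrt_coeff n * inv_sqrt_coeff k * (a (n + k) - a (Suc (n + k))))
      = (\<Sum>n\<le>N. inv_sqrt_coeff n * ((\<Sum>k\<le>N. sqrt_coeff k * a (n + k)) - inv_sqrt_coeff N * a (n + Suc N)))"
    unfolding inv_sqrt_coeff_summation_by_parts[of "\<lambda>k. a (n + k)" N for n, symmetric]
    by (simp add: sum_distrib_left mult.assoc)
  also have "\<dots> \<le> (\<Sum>n\<le>N. inv_sqrt_coeff n * (\<Sum>k\<le>N. sqrt_coeff k * a (n + k)))"
    using a inv_sqrt_coeff_nonneg by (intro sum_mono mult_left_mono) auto
  also have "\<dots> = (\<Sum>(n,k)\<in>{..N} \<times> {..N}. inv_sqrt_coeff n * sqrt_coeff k * a (n + k))"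
    by (simp add: sum_distrib_left mult.assoc sum.cartesian_product)
  also have "\<dots> \<le> (\<Sum>(n,k)\<in>{(n,k). n + k \<le> N}. inv_sqrt_coeff n * sqrt_coeff k * a (n + k))"
  proof -
    have sub: "{(n,k). n + k \<le> N} \<subseteq> {..N} \<times> {..N}" by auto
    have "(\<Sum>(n,k)\<in>{..N} \<times> {..N} - {(n,k). n + k \<le> N}. inv_sqrt_coeff n * sqrt_coeff k * a (n + k)) \<le> 0"
    proof (rule sum_nonpos)
      fix x assume x: "x \<in> {..N} \<times> {..N} - {(n,k). n + k \<le> N}"
      obtain n k where nk: "x = (n, k)" by force
      have "k > 0" using x nk by (cases k) auto
      then have "inv_sqrt_coeff n * sqrt_coeff k * a (n + k) \<le> 0"
        using a inv_sqrt_coeff_nonneg sqrt_coeff_le_0 by (intro mult_nonpos_nonneg mult_nonneg_nonpos)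
      then show "(case x of (n, k) \<Rightarrow> inv_sqrt_coeff n * sqrt_coeff k * a (n + k)) \<le> 0" using nk by simp
    qed
    then show ?thesis
      using sum.subset_diff[OF sub, of "\<lambda>(n,k). inv_sqrt_coeff n * sqrt_coeff k * a (n + k)"] by simp
  qed
  also have "\<dots> = (\<Sum>m\<le>N. \<Sum>n\<le>m. inv_sqrt_coeff n * sqrt_coeff (m - n) * a m)"
    by (simp add: sum.triangle_reindex_eq)
  also have "\<dots> = (\<Sum>m\<le>N. (\<Sum>k\<le>m. inv_sqrt_coeff (m - k) * sqrt_coeff k) * a m)"
  proof (rule sum.cong)
    fix m
    show "(\<Sum>n\<le>m. inv_sqrt_coeff n * sqrt_coeff (m - n) * a m) = (\<Sum>k\<le>m. inv_sqrt_coeff (m - k) * sqrt_coeff k) * a m"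
      unfolding sum_distrib_right
      by (rule sum.reindex_bij_witness[of _ "\<lambda>k. m - k" "\<lambda>k. m - k"]) auto
  qed simp
  also have "\<dots> = a 0"
    by (simp add: coeff_convolution if_distrib[of "\<lambda>x. x * _"] cong: if_cong)
  finally show ?thesis .
qed

text \<open>The identity \<open>1 / sqrt (1 - x) \<cdot> sqrt (1 - x) = 1\<close>, applied to a sequence of moments \<open>a\<close> in
  place of the powers of \<open>x\<close>. Since \<open>sqrt_coeff k \<le> 0\<close> for \<open>k > 0\<close>, taking absolute values in the
  convolution of the two coefficient sequences costs only a factor \<open>2\<close>, so the double series
  converges absolutely as soon as \<open>\<Sum>n. inv_sqrt_coeff n * a n\<close> does.\<close>

lemma coeff_has_sum:
  assumes a: "\<And>n. 0 \<le> a n" and s: "summable (\<lambda>n. inv_sqrt_coeff n * a n)"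
  shows "((\<lambda>(n,k). inv_sqrt_coeff n * sqrt_coeff k * a (n + k)) has_sum a 0) UNIV"
proof -
  let ?f = "\<lambda>(m,k). inv_sqrt_coeff (m - k) * sqrt_coeff k * a m"
  let ?T = "Sigma UNIV (\<lambda>m::nat. {..m})"
  have fin: "(\<lambda>k. norm (?f (m,k))) summable_on {..m}" for m by (rule summable_on_finite) simp
  have bound: "(\<Sum>k\<le>m. norm (?f (m,k))) \<le> 2 * (inv_sqrt_coeff m * a m)" for m
  proof -
    have "(\<Sum>k\<le>m. norm (?f (m,k))) = (\<Sum>k\<le>m. inv_sqrt_coeff (m - k) * ((if k = 0 then 2 else 0) - sqrt_coeff k)) * a m"
      using a inv_sqrt_coeff_nonneg by (simp add: abs_mult sqrt_coeff_abs sum_distrib_right)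
    also have "(\<Sum>k\<le>m. inv_sqrt_coeff (m - k) * ((if k = 0 then 2 else 0) - sqrt_coeff k)) = 2 * inv_sqrt_coeff m - (if m = 0 then 1 else 0)"
      by (simp add: right_diff_distrib sum_subtractf coeff_convolution if_distrib[of "\<lambda>x. _ * x"] cong: if_cong)
    also have "(2 * inv_sqrt_coeff m - (if m = 0 then 1 else 0)) * a m \<le> 2 * (inv_sqrt_coeff m * a m)"
      using a[of m] by (simp add: algebra_simps)
    finally show ?thesis .
  qed
  have "(\<lambda>m. inv_sqrt_coeff m * a m) summable_on UNIV"
    by (rule norm_summable_imp_summable_on) (use s a inv_sqrt_coeff_nonneg in simp)
  then have "(\<lambda>m. 2 * (inv_sqrt_coeff m * a m)) summable_on UNIV" by (rule summable_on_cmult_right)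
  then have "(\<lambda>m. norm (\<Sum>\<^sub>\<infinity>k\<in>{..m}. norm (?f (m,k)))) summable_on UNIV"
    by (rule summable_on_comparison_test) (use bound in \<open>simp_all add: sum_nonneg\<close>)
  then have "(\<lambda>x. norm (?f x)) summable_on ?T"
    using fin by (subst Infinite_Sum.abs_summable_on_Sigma_iff) auto
  then have "?f summable_on ?T" by (rule abs_summable_summable)
  then obtain S where S: "(?f has_sum S) ?T" by (auto simp: summable_on_def)
  have "((\<lambda>m. \<Sum>k\<le>m. ?f (m,k)) has_sum S) UNIV"
    by (rule has_sum_SigmaD[OF S]) (rule has_sum_finite, simp)
  moreover have "(\<Sum>k\<le>m. ?f (m,k)) = (if m = 0 then a 0 else 0)" for m
    using coeff_convolution[of m] by (simp flip: sum_distrib_right)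
  ultimately have "((\<lambda>m::nat. if m = 0 then a 0 else 0) has_sum S) UNIV"
    by simp
  moreover have "((\<lambda>m::nat. if m = 0 then a 0 else 0) has_sum a 0) UNIV"
    by (rule has_sum_finite_neutralI[of "{0}"]) auto
  ultimately have "S = a 0" by (rule has_sum_unique)
  with S have "(?f has_sum a 0) ?T" by simp
  then show ?thesis
    by (subst (asm) has_sum_reindex_bij_witness[where T=UNIV and i="\<lambda>(n,k). (n + k, k)"
          and j="\<lambda>(m,k). (m - k, k)" and h="\<lambda>(n,k). inv_sqrt_coeff n * sqrt_coeff k * a (n + k)" and s'="a 0"]) auto
qed

lemma
  assumes a: "\<And>n. 0 \<le> a n" and s: "summable (\<lambda>n. inv_sqrt_coeff n * a n)"
  shows coeff_sums: "\<exists>A. (\<forall>n. (\<lambda>k. sqrt_coeff k * a (n + k)) sums A n) \<and> (\<lambda>n. inv_sqrt_coeff n * A n) sums a 0"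
    and coeff_sums_swapped: "\<exists>B. (\<forall>k. (\<lambda>n. inv_sqrt_coeff n * a (n + k)) sums B k) \<and> (\<lambda>k. sqrt_coeff k * B k) sums a 0"
proof -
  have dn: "inv_sqrt_coeff n \<noteq> 0" for n using inv_sqrt_coeff_pos[of n] by simp
  let ?g = "\<lambda>(n,k). inv_sqrt_coeff n * sqrt_coeff k * a (n + k)"
  have g: "(?g has_sum a 0) (UNIV \<times> UNIV)" using coeff_has_sum[OF a s] by simp
  show "\<exists>A. (\<forall>n. (\<lambda>k. sqrt_coeff k * a (n + k)) sums A n) \<and> (\<lambda>n. inv_sqrt_coeff n * A n) sums a 0"
  proof -
    define A where "A n = (\<Sum>\<^sub>\<infinity>k. sqrt_coeff k * a (n + k))" for n
    have A: "((\<lambda>k. sqrt_coeff k * a (n + k)) has_sum A n) UNIV" for n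
    proof -
      have "(\<lambda>k. inv_sqrt_coeff n * sqrt_coeff k * a (n + k)) summable_on UNIV"
        using summable_on_SigmaD1[of "\<lambda>n k. inv_sqrt_coeff n * sqrt_coeff k * a (n + k)" UNIV "\<lambda>_. UNIV" n] g
        by (auto simp: summable_on_def)
      then have "(\<lambda>k. inv_sqrt_coeff n * (sqrt_coeff k * a (n + k))) summable_on UNIV" by (simp add: mult.assoc)
      then show ?thesis unfolding A_def using dn[of n] by (simp add: summable_on_cmult_right')
    qed
    have "((\<lambda>n. inv_sqrt_coeff n * A n) has_sum a 0) UNIV"
      by (rule has_sum_SigmaD[OF g]) (use has_sum_cmult_right[OF A] in \<open>simp add: mult.assoc\<close>)
    then show ?thesis using A by (blast intro: has_sum_imp_sums)
  qed
  have g': "((\<lambda>(k,n). inv_sqrt_coeff n * sqrt_coeff k * a (n + k)) has_sum a 0) (UNIV \<times> UNIV)"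
    using g has_sum_swap[where f="?g" and A=UNIV and B=UNIV and S="a 0"] by simp
  show "\<exists>B. (\<forall>k. (\<lambda>n. inv_sqrt_coeff n * a (n + k)) sums B k) \<and> (\<lambda>k. sqrt_coeff k * B k) sums a 0"
  proof -
    define B where "B k = (\<Sum>\<^sub>\<infinity>n. inv_sqrt_coeff n * a (n + k))" for k
    have B: "((\<lambda>n. inv_sqrt_coeff n * a (n + k)) has_sum B k) UNIV" for k
    proof -
      have "(\<lambda>n. inv_sqrt_coeff n * sqrt_coeff k * a (n + k)) summable_on UNIV"
        using summable_on_SigmaD1[of "\<lambda>k n. inv_sqrt_coeff n * sqrt_coeff k * a (n + k)" UNIV "\<lambda>_. UNIV" k] g'
        by (auto simp: summable_on_def)
      then have "(\<lambda>n. sqrt_coeff k * (inv_sqrt_coeff n * a (n + k))) summable_on UNIV" by (simp add: mult_ac)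
      then show ?thesis unfolding B_def using sqrt_coeff_nonzero[of k] by (simp add: summable_on_cmult_right')
    qed
    have "((\<lambda>n. inv_sqrt_coeff n * sqrt_coeff k * a (n + k)) has_sum sqrt_coeff k * B k) UNIV" for k
      using has_sum_cmult_right[OF B, of "sqrt_coeff k" k] by (simp add: mult_ac)
    then have "((\<lambda>k. sqrt_coeff k * B k) has_sum a 0) UNIV"
      by (intro has_sum_SigmaD[OF g']) simp
    then show ?thesis using B by (blast intro: has_sum_imp_sums)
  qed
qed

section \<open>The kagome lattice\<close>

text \<open>The hexagons \<open>n\<close>, \<open>n + (1,0)\<close>, \<open>n + (0,1)\<close> surround the vertex \<open>Up n\<close>. Each of its three edges
  separates two of them, and the edge is numbered by the omitted one, in this order.\<close>

definition edge0 :: "int \<times> int \<Rightarrow> hex_vertex set" where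
  "edge0 n = {Up (fst n) (snd n), Down (fst n) (snd n)}"
definition edge1 :: "int \<times> int \<Rightarrow> hex_vertex set" where
  "edge1 n = {Up (fst n) (snd n), Down (fst n - 1) (snd n)}"
definition edge2 :: "int \<times> int \<Rightarrow> hex_vertex set" where
  "edge2 n = {Up (fst n) (snd n), Down (fst n) (snd n - 1)}"

lemmas edge_defs = edge0_def edge1_def edge2_def

lemma edge_distinct [simp]:
  "edge0 m \<noteq> edge1 n" "edge0 m \<noteq> edge2 n" "edge1 m \<noteq> edge2 n"
  "edge1 m \<noteq> edge0 n" "edge2 m \<noteq> edge0 n" "edge2 m \<noteq> edge1 n"
  by (auto simp: edge_defs doubleton_eq_iff)

lemma edge_inject [simp]:
  "edge0 m = edge0 n \<longleftrightarrow> m = n" "edge1 m = edge1 n \<longleftrightarrow> m = n" "edge2 m = edge2 n \<longleftrightarrow> m = n"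
  by (auto simp: edge_defs doubleton_eq_iff prod_eq_iff)

lemma edge_in_graph [simp]: "edge0 n \<in> \<Gamma>\<^sub>0" "edge1 n \<in> \<Gamma>\<^sub>0" "edge2 n \<in> \<Gamma>\<^sub>0"
  by (auto simp: edge_defs honeycomb_edges_def)

lemma edge_cases:
  assumes "x \<in> \<Gamma>\<^sub>0"
  obtains n where "x = edge0 n" | n where "x = edge1 n" | n where "x = edge2 n"
proof -
  obtain j k where "x = {Up j k, Down j k} \<or> x = {Up j k, Down (j - 1) k} \<or> x = {Up j k, Down j (k - 1)}"
    using assms by (auto simp: honeycomb_edges_def)
  then show thesis
    using that[of "(j, k)"] by (auto simp: edge_defs)
qed

lemma edge_disjoint:
  "edge0 n \<inter> edge0 m = {} \<longleftrightarrow> \<not> (m = n)"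
  "edge1 n \<inter> edge1 m = {} \<longleftrightarrow> \<not> (m = n)"
  "edge2 n \<inter> edge2 m = {} \<longleftrightarrow> \<not> (m = n)"
  "edge0 n \<inter> edge1 m = {} \<longleftrightarrow> \<not> (m = n \<or> m = n + (1,0))"
  "edge0 n \<inter> edge2 m = {} \<longleftrightarrow> \<not> (m = n \<or> m = n + (0,1))"
  "edge1 n \<inter> edge0 m = {} \<longleftrightarrow> \<not> (m = n \<or> m = n - (1,0))"
  "edge1 n \<inter> edge2 m = {} \<longleftrightarrow> \<not> (m = n \<or> m = n - (1,0) + (0,1))"
  "edge2 n \<inter> edge0 m = {} \<longleftrightarrow> \<not> (m = n \<or> m = n - (0,1))"
  "edge2 n \<inter> edge1 m = {} \<longleftrightarrow> \<not> (m = n \<or> m = n - (0,1) + (1,0))"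
  by (auto simp: edge_defs prod_eq_iff)

lemma edge_adj_edge0:
  "{y. edge_adj (edge0 n) y} = {edge1 n, edge2 n, edge1 (n + (1,0)), edge2 (n + (0,1))}"
proof (intro set_eqI iffI)
  fix y assume "y \<in> {y. edge_adj (edge0 n) y}"
  then have "y \<in> \<Gamma>\<^sub>0" and y: "edge_adj (edge0 n) y" by (auto simp: edge_adj_def)
  from this(1) show "y \<in> {edge1 n, edge2 n, edge1 (n + (1,0)), edge2 (n + (0,1))}"
    by (cases y rule: edge_cases) (use y in \<open>auto simp: edge_adj_def edge_disjoint\<close>)
qed (auto simp: edge_adj_def edge_disjoint)

lemma edge_adj_edge1:
  "{y. edge_adj (edge1 n) y} = {edge0 n, edge2 n, edge0 (n - (1,0)), edge2 (n - (1,0) + (0,1))}"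
proof (intro set_eqI iffI)
  fix y assume "y \<in> {y. edge_adj (edge1 n) y}"
  then have "y \<in> \<Gamma>\<^sub>0" and y: "edge_adj (edge1 n) y" by (auto simp: edge_adj_def)
  from this(1) show "y \<in> {edge0 n, edge2 n, edge0 (n - (1,0)), edge2 (n - (1,0) + (0,1))}"
    by (cases y rule: edge_cases) (use y in \<open>auto simp: edge_adj_def edge_disjoint\<close>)
qed (auto simp: edge_adj_def edge_disjoint)

lemma edge_adj_edge2:
  "{y. edge_adj (edge2 n) y} = {edge0 n, edge1 n, edge0 (n - (0,1)), edge1 (n - (0,1) + (1,0))}"
proof (intro set_eqI iffI)
  fix y assume "y \<in> {y. edge_adj (edge2 n) y}"
  then have "y \<in> \<Gamma>\<^sub>0" and y: "edge_adj (edge2 n) y" by (auto simp: edge_adj_def)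
  from this(1) show "y \<in> {edge0 n, edge1 n, edge0 (n - (0,1)), edge1 (n - (0,1) + (1,0))}"
    by (cases y rule: edge_cases) (use y in \<open>auto simp: edge_adj_def edge_disjoint\<close>)
qed (auto simp: edge_adj_def edge_disjoint)

text \<open>The eigenvalue equation at an edge says that these sums at its two ends cancel: each of the four
  neighbours of the edge meets exactly one of the ends, and the edge itself meets both.\<close>

definition up_sum :: "(hex_vertex set \<Rightarrow> complex) \<Rightarrow> int \<times> int \<Rightarrow> complex" where
  "up_sum v n = v (edge0 n) + v (edge1 n) + v (edge2 n)"
definition down_sum :: "(hex_vertex set \<Rightarrow> complex) \<Rightarrow> int \<times> int \<Rightarrow> complex" where
  "down_sum v n = v (edge0 n) + v (edge1 (n + (1,0))) + v (edge2 (n + (0,1)))"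

lemma pair_shift_neq [simp]:
  fixes n :: "int \<times> int"
  shows "(a, b) \<noteq> 0 \<Longrightarrow> n + (a, b) \<noteq> n" "(a, b) \<noteq> 0 \<Longrightarrow> n \<noteq> n + (a, b)"
    "(a, b) \<noteq> 0 \<Longrightarrow> n - (a, b) \<noteq> n" "(a, b) \<noteq> 0 \<Longrightarrow> n \<noteq> n - (a, b)"
  by (auto simp: prod_eq_iff)

lemma eigen_edge0: "- laplacian v (edge0 n) = 6 * v (edge0 n) \<longleftrightarrow> up_sum v n + down_sum v n = 0"
proof -
  have "- laplacian v (edge0 n) - 6 * v (edge0 n) = - (up_sum v n + down_sum v n)"
    unfolding laplacian_def edge_adj_edge0 up_sum_def down_sum_def
    by (simp add: zero_prod_def algebra_simps)
  then show ?thesis by (metis eq_iff_diff_eq_0 neg_equal_0_iff_equal)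
qed

lemma eigen_edge1:
  "- laplacian v (edge1 n) = 6 * v (edge1 n) \<longleftrightarrow> up_sum v n + down_sum v (n - (1,0)) = 0"
proof -
  have "- laplacian v (edge1 n) - 6 * v (edge1 n) = - (up_sum v n + down_sum v (n - (1,0)))"
    unfolding laplacian_def edge_adj_edge1 up_sum_def down_sum_def
    by (simp add: zero_prod_def prod_eq_iff algebra_simps)
  then show ?thesis by (metis eq_iff_diff_eq_0 neg_equal_0_iff_equal)
qed

lemma eigen_edge2:
  "- laplacian v (edge2 n) = 6 * v (edge2 n) \<longleftrightarrow> up_sum v n + down_sum v (n - (0,1)) = 0"
proof -
  have "- laplacian v (edge2 n) - 6 * v (edge2 n) = - (up_sum v n + down_sum v (n - (0,1)))"
    unfolding laplacian_def edge_adj_edge2 up_sum_def down_sum_def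
    by (simp add: zero_prod_def prod_eq_iff algebra_simps)
  then show ?thesis by (metis eq_iff_diff_eq_0 neg_equal_0_iff_equal)
qed

lemma E6_iff: "v \<in> E6 \<longleftrightarrow> v \<in> ell2 \<Gamma>\<^sub>0 \<and> (\<forall>n. up_sum v n + down_sum v n = 0 \<and>
    up_sum v n + down_sum v (n - (1,0)) = 0 \<and> up_sum v n + down_sum v (n - (0,1)) = 0)"
proof -
  have "(\<forall>x\<in>\<Gamma>\<^sub>0. - laplacian v x = 6 * v x) \<longleftrightarrow> (\<forall>n. - laplacian v (edge0 n) = 6 * v (edge0 n) \<and>
    - laplacian v (edge1 n) = 6 * v (edge1 n) \<and> - laplacian v (edge2 n) = 6 * v (edge2 n))"
    using edge_cases by (metis edge_in_graph)
  then show ?thesis unfolding E6_def eigen_edge0 eigen_edge1 eigen_edge2 by blast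
qed

lemma E6_subset: "E6 \<subseteq> ell2 \<Gamma>\<^sub>0"
  by (auto simp: E6_def)

lemma laplacian_diff: "laplacian (\<lambda>x. u x - v x) x = laplacian u x - laplacian v x"
  unfolding laplacian_def by (simp add: sum_subtractf[symmetric] algebra_simps)

lemma laplacian_sum: "laplacian (\<lambda>x. \<Sum>i\<in>S. c i * w i x) x = (\<Sum>i\<in>S. c i * laplacian (w i) x)"
  unfolding laplacian_def sum_distrib_left
  by (subst sum.swap) (simp add: sum_subtractf[symmetric] right_diff_distrib)

lemma E6_laplacian: "u \<in> E6 \<Longrightarrow> x \<in> \<Gamma>\<^sub>0 \<Longrightarrow> laplacian u x = - (6 * u x)"
  by (auto simp: E6_def minus_equation_iff[of "laplacian u x"])

lemma E6_diff:
  assumes "u \<in> E6" "v \<in> E6"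
  shows "(\<lambda>x. u x - v x) \<in> E6"
proof -
  have "- laplacian (\<lambda>x. u x - v x) x = 6 * (u x - v x)" if "x \<in> \<Gamma>\<^sub>0" for x
    using E6_laplacian[OF assms(1) that] E6_laplacian[OF assms(2) that]
    by (simp add: laplacian_diff)
  moreover have "(\<lambda>x. u x - v x) \<in> ell2 \<Gamma>\<^sub>0"
    by (rule ell2_diff) (use assms E6_subset in auto)
  ultimately show ?thesis by (simp add: E6_def)
qed

lemma E6_sum:
  assumes "finite S" "\<And>i. i \<in> S \<Longrightarrow> w i \<in> E6"
  shows "(\<lambda>x. \<Sum>i\<in>S. c i * w i x) \<in> E6"
proof -
  have "- laplacian (\<lambda>x. \<Sum>i\<in>S. c i * w i x) x = 6 * (\<Sum>i\<in>S. c i * w i x)" if "x \<in> \<Gamma>\<^sub>0" for x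
  proof -
    have "laplacian (\<lambda>x. \<Sum>i\<in>S. c i * w i x) x = (\<Sum>i\<in>S. c i * (- (6 * w i x)))"
      unfolding laplacian_sum using E6_laplacian[OF assms(2) that] by simp
    then show ?thesis by (simp add: sum_negf sum_distrib_left mult_ac)
  qed
  moreover have "(\<lambda>x. \<Sum>i\<in>S. c i * w i x) \<in> ell2 \<Gamma>\<^sub>0"
    using ell2_sum[of S w "\<Gamma>\<^sub>0" c] assms E6_subset by blast
  ultimately show ?thesis by (simp add: E6_def)
qed

lemma E6_pointwise_limit:
  assumes F: "F \<noteq> bot" and u: "\<forall>\<^sub>F i in F. u i \<in> E6" and w: "w \<in> ell2 \<Gamma>\<^sub>0"
    and lim: "\<And>x. ((\<lambda>i. u i x) \<longlongrightarrow> w x) F"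
  shows "w \<in> E6"
proof -
  have "- laplacian w x = 6 * w x" if x: "x \<in> \<Gamma>\<^sub>0" for x
  proof (rule tendsto_unique[OF F])
    show "((\<lambda>i. - laplacian (u i) x) \<longlongrightarrow> - laplacian w x) F"
      unfolding laplacian_def by (intro tendsto_intros lim)
    have l: "((\<lambda>i. 6 * u i x) \<longlongrightarrow> 6 * w x) F" by (intro tendsto_intros lim)
    show "((\<lambda>i. - laplacian (u i) x) \<longlongrightarrow> 6 * w x) F"
      by (rule Lim_transform_eventually[OF l]) (use u x in \<open>auto elim!: eventually_mono simp: E6_def\<close>)
  qed
  then show ?thesis using w by (simp add: E6_def)
qed

lemma ell2_finite_large:
  assumes v: "v \<in> ell2 V" and \<epsilon>: "\<epsilon> > 0"
  shows "finite {x. \<epsilon> \<le> cmod (v x)}"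
proof -
  obtain A where A: "finite A" "(\<lambda>x. if x \<in> A then 0 else v x) \<in> ell2 V"
    "ell2_norm V (\<lambda>x. if x \<in> A then 0 else v x) < \<epsilon>"
    by (rule ell2_small_tail[OF v \<epsilon>])
  have "cmod (v x) < \<epsilon>" if "x \<notin> A" for x
  proof (cases "x \<in> V")
    case True
    then show ?thesis using L2_set_le_ell2_norm[OF A(2), of "{x}"] that A(3) by simp
  next
    case False
    then show ?thesis using ell2_outside[OF v False] \<epsilon> by simp
  qed
  then have "{x. \<epsilon> \<le> cmod (v x)} \<subseteq> A" by (auto simp: not_less[symmetric])
  then show ?thesis using A(1) finite_subset by blast
qed

lemma ell2_tendsto_0:
  fixes g :: "nat \<Rightarrow> 'a"
  assumes "v \<in> ell2 V" "inj g"
  shows "(\<lambda>k. v (g k)) \<longlonglongrightarrow> 0"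
proof (rule tendstoI)
  fix \<epsilon> :: real assume "\<epsilon> > 0"
  then have "finite (g -` {x. \<epsilon> \<le> cmod (v x)})"
    using ell2_finite_large[OF assms(1)] assms(2) by (intro finite_vimageI) auto
  then have "\<forall>\<^sub>F k in sequentially. k \<notin> g -` {x. \<epsilon> \<le> cmod (v x)}"
    by (simp add: cofinite_eq_sequentially[symmetric] eventually_cofinite)
  then show "\<forall>\<^sub>F k in sequentially. dist (v (g k)) 0 < \<epsilon>"
    by (auto elim!: eventually_mono)
qed

text \<open>The cancellation along edges makes the vertex sums constant up to sign on the whole
  honeycomb; a square-summable function has no room for a constant other than zero.\<close>

lemma E6_vertex_sums:
  assumes v: "v \<in> E6"
  shows "up_sum v n = 0" and "down_sum v n = 0"
proof -
  have v2: "v \<in> ell2 \<Gamma>\<^sub>0" and eq: "\<And>n. up_sum v n + down_sum v n = 0"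
    "\<And>n. up_sum v n + down_sum v (n - (1,0)) = 0"
    using v by (auto simp: E6_iff)
  have step: "up_sum v (n + (1,0)) = up_sum v n" for n
    using eq(1)[of n] eq(2)[of "n + (1,0)"] by (simp add: eq_neg_iff_add_eq_0[symmetric])
  have const: "up_sum v (n + (int k, 0)) = up_sum v n" for k
  proof (induction k)
    case (Suc k)
    have "n + (int (Suc k), 0) = n + (int k, 0) + (1,0)" by (simp add: prod_eq_iff)
    then show ?case using step[of "n + (int k, 0)"] Suc by metis
  qed (simp add: zero_prod_def[symmetric])
  have "(\<lambda>k. up_sum v (n + (int k, 0))) \<longlonglongrightarrow> 0 + 0 + 0"
    unfolding up_sum_def by (intro tendsto_add ell2_tendsto_0[OF v2]) (auto simp: inj_def)
  then show u: "up_sum v n = 0"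
    unfolding const by (simp add: LIMSEQ_const_iff)
  then show "down_sum v n = 0" using eq(1)[of n] by simp
qed

section \<open>Harmonic functions on the triangular lattice\<close>

definition neighbours :: "(int \<times> int) set" where
  "neighbours = {(1,0), (-1,0), (0,1), (0,-1), (1,-1), (-1,1)}"

lemma sum_neighbours: "(\<Sum>s\<in>neighbours. g s) =
    g (1,0) + g (-1,0) + g (0,1) + g (0,-1) + g (1,-1) + (g (-1,1) :: 'a::comm_monoid_add)"
  by (simp add: neighbours_def add.assoc)

lemma sum_neighbours_uminus: "(\<Sum>s\<in>neighbours. g (- s)) = (\<Sum>s\<in>neighbours. g s :: 'a::comm_monoid_add)"
  by (simp add: sum_neighbours add_ac)

text \<open>The set where \<open>cmod a\<close> is maximal is finite and, by the mean value property, closed under the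
  translation by \<open>(1,0)\<close>.\<close>

lemma harmonic_vanishing_at_infinity:
  fixes a :: "int \<times> int \<Rightarrow> complex"
  assumes harm: "\<And>n. 6 * a n = (\<Sum>s\<in>neighbours. a (n + s))"
    and fin: "\<And>\<epsilon>. \<epsilon> > 0 \<Longrightarrow> finite {n. \<epsilon> \<le> cmod (a n)}"
  shows "a n = 0"
proof (rule ccontr)
  assume n: "a n \<noteq> 0"
  let ?S = "{m. cmod (a n) \<le> cmod (a m)}"
  have S: "finite ?S" "n \<in> ?S" using fin[of "cmod (a n)"] n by auto
  define M where "M = Max ((\<lambda>m. cmod (a m)) ` ?S)"
  have M: "M \<in> (\<lambda>m. cmod (a m)) ` ?S" unfolding M_def by (rule Max_in, use S in simp, use S in blast)
  have le: "cmod (a m) \<le> M" for m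
  proof (cases "m \<in> ?S")
    case True
    then show ?thesis unfolding M_def using S by (intro Max_ge) auto
  next
    case False
    then show ?thesis using M by auto
  qed
  let ?T = "{m. M \<le> cmod (a m)}"
  have "0 < cmod (a n)" using n by simp
  also have "cmod (a n) \<le> M" by (rule le)
  finally have "M > 0" .
  then have T: "finite ?T" by (rule fin)
  have step: "m + (1,0) \<in> ?T" if "m \<in> ?T" for m
  proof -
    have "6 * M \<le> cmod (6 * a m)" using that by (simp add: norm_mult)
    also have "\<dots> \<le> (\<Sum>s\<in>neighbours. cmod (a (m + s)))" unfolding harm by (rule norm_sum)
    also have "\<dots> \<le> cmod (a (m + (1,0))) + M + M + M + M + M"
      unfolding sum_neighbours by (intro add_mono le order_refl)
    finally show ?thesis by simp
  qed
  obtain m where m: "m \<in> ?T" using M by auto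
  have "m + (int k, 0) \<in> ?T" for k
  proof (induction k)
    case (Suc k)
    have "m + (int (Suc k), 0) = m + (int k, 0) + (1,0)" by (simp add: prod_eq_iff)
    then show ?case using step[OF Suc] by metis
  qed (use m in \<open>simp add: zero_prod_def[symmetric]\<close>)
  then have "range (\<lambda>k. m + (int k, 0)) \<subseteq> ?T" by auto
  moreover have "inj (\<lambda>k. m + (int k, 0))" by (auto simp: inj_def)
  ultimately show False using T finite_subset range_inj_infinite by blast
qed


section \<open>Simple random walk\<close>

fun walk :: "nat \<Rightarrow> int \<times> int \<Rightarrow> real" where
  "walk 0 m = (if m = 0 then 1 else 0)"
| "walk (Suc n) m = (\<Sum>s\<in>neighbours. walk n (m + s)) / 6"

lemma walk_nonneg: "0 \<le> walk n m"
  by (induction n arbitrary: m) (auto intro!: sum_nonneg)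

section \<open>Alternating functions on hexagons\<close>

text \<open>The functions \<open>\<psi> m\<close> in coordinates. Going around a hexagon the signs alternate, and the two hexagons
  at an edge contribute opposite signs; \<open>s\<close> is the sign left undetermined.\<close>

locale hexagon_functions =
  fixes s :: complex and \<psi> :: "int \<times> int \<Rightarrow> hex_vertex set \<Rightarrow> complex"
  assumes sign: "s = 1 \<or> s = -1"
    and psi_edge0: "\<psi> m (edge0 n) = s * ((if m = n + (0,1) then 1 else 0) - (if m = n + (1,0) then 1 else 0))"
    and psi_edge1: "\<psi> m (edge1 n) = s * ((if m = n then 1 else 0) - (if m = n + (0,1) then 1 else 0))"
    and psi_edge2: "\<psi> m (edge2 n) = s * ((if m = n + (1,0) then 1 else 0) - (if m = n then 1 else 0))"
    and psi_outside: "x \<notin> \<Gamma>\<^sub>0 \<Longrightarrow> \<psi> m x = 0"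
begin

text \<open>The discrete curl: at an edge this sum has two terms, and its value is, up to sign, the difference
  of \<open>\<phi>\<close> across that edge.\<close>

definition curl :: "(int \<times> int \<Rightarrow> complex) \<Rightarrow> hex_vertex set \<Rightarrow> complex" where
  "curl \<phi> x = (\<Sum>\<^sub>\<infinity>m. \<phi> m * \<psi> m x)"

lemma infsum_two_points:
  fixes \<phi> :: "int \<times> int \<Rightarrow> complex"
  assumes "a \<noteq> b"
  shows "(\<Sum>\<^sub>\<infinity>m. \<phi> m * (s * ((if m = a then 1 else 0) - (if m = b then 1 else 0)))) = s * (\<phi> a - \<phi> b)"
  by (rule infsumI, rule has_sum_finite_neutralI[of "{a, b}"])
     (use assms in \<open>auto simp: algebra_simps\<close>)

lemma curl_edge0: "curl \<phi> (edge0 n) = s * (\<phi> (n + (0,1)) - \<phi> (n + (1,0)))"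
  unfolding curl_def psi_edge0 by (rule infsum_two_points) (simp add: prod_eq_iff)

lemma curl_edge1: "curl \<phi> (edge1 n) = s * (\<phi> n - \<phi> (n + (0,1)))"
  unfolding curl_def psi_edge1 by (rule infsum_two_points) (simp add: prod_eq_iff)

lemma curl_edge2: "curl \<phi> (edge2 n) = s * (\<phi> (n + (1,0)) - \<phi> n)"
  unfolding curl_def psi_edge2 by (rule infsum_two_points) (simp add: prod_eq_iff)

lemma curl_outside: "x \<notin> \<Gamma>\<^sub>0 \<Longrightarrow> curl \<phi> x = 0"
  unfolding curl_def by (simp add: psi_outside)

text \<open>All that later linearity and limit arguments use about \<open>curl\<close>, uniformly in the kind of edge;
  \<open>\<sigma>\<close> is zero outside the graph.\<close>

lemma curl_two_point:
  "\<exists>(\<sigma>::real) a b. \<forall>\<phi>. curl \<phi> x = of_real \<sigma> * (\<phi> a - \<phi> b)"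
proof -
  obtain r :: real where r: "s = of_real r" using sign by (auto intro: that[of 1] that[of "-1"])
  show ?thesis
  proof (cases "x \<in> \<Gamma>\<^sub>0")
    case True
    then show ?thesis
      by (cases x rule: edge_cases) (use r curl_edge0 curl_edge1 curl_edge2 in metis)+
  qed (use curl_outside in \<open>auto intro: exI[of _ 0]\<close>)
qed

lemma curl_eigen:
  assumes "curl \<phi> \<in> ell2 \<Gamma>\<^sub>0"
  shows "curl \<phi> \<in> E6"
  unfolding E6_iff up_sum_def down_sum_def curl_edge0 curl_edge1 curl_edge2
  using assms by (simp add: algebra_simps add.commute)

lemma inner_psi:
  "ell2_inner \<Gamma>\<^sub>0 v (\<psi> m) = s * (v (edge1 m) - v (edge1 (m - (0,1))) - v (edge2 m)
     + v (edge2 (m - (1,0))) - v (edge0 (m - (1,0))) + v (edge0 (m - (0,1))))"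
proof -
  let ?B = "{edge1 m, edge1 (m - (0,1)), edge2 m, edge2 (m - (1,0)), edge0 (m - (1,0)), edge0 (m - (0,1))}"
  have cs: "cnj s = s" using sign by auto
  have zero: "\<psi> m x = 0" if "x \<in> \<Gamma>\<^sub>0 - ?B" for x
  proof -
    have x: "x \<in> \<Gamma>\<^sub>0" "x \<notin> ?B" using that by auto
    from x(1) show ?thesis
      by (cases x rule: edge_cases) (use x(2) in \<open>auto simp: psi_edge0 psi_edge1 psi_edge2\<close>)
  qed
  have ne: "m - (0,1) \<noteq> m - (1,0)" "m \<noteq> m - (0,1) + (1,0)" "m \<noteq> m - (1,0) + (0,1)"
    "m - (0,1) \<noteq> m" "m - (1,0) \<noteq> m"
    by (auto simp: prod_eq_iff)
  have "((\<lambda>x. v x * cnj (\<psi> m x)) has_sum (\<Sum>x\<in>?B. v x * cnj (\<psi> m x))) \<Gamma>\<^sub>0"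
    by (rule has_sum_finite_neutralI[of ?B]) (auto simp: zero)
  moreover have "(\<Sum>x\<in>?B. v x * cnj (\<psi> m x)) = s * (v (edge1 m) - v (edge1 (m - (0,1))) - v (edge2 m)
     + v (edge2 (m - (1,0))) - v (edge0 (m - (1,0))) + v (edge0 (m - (0,1))))"
    using ne ne[symmetric] by (simp add: psi_edge0 psi_edge1 psi_edge2 cs algebra_simps)
  ultimately show ?thesis unfolding ell2_inner_def by (simp add: infsumI)
qed

lemma psi_ell2: "\<psi> m \<in> ell2 \<Gamma>\<^sub>0"
proof -
  let ?B = "{edge1 m, edge1 (m - (0,1)), edge2 m, edge2 (m - (1,0)), edge0 (m - (1,0)), edge0 (m - (0,1))}"
  have zero: "\<psi> m x = 0" if "x \<in> \<Gamma>\<^sub>0" "x \<notin> ?B" for x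
    using that(1)
    by (cases x rule: edge_cases) (use that(2) in \<open>auto simp: psi_edge0 psi_edge1 psi_edge2\<close>)
  have "(\<lambda>x. (cmod (\<psi> m x))\<^sup>2) summable_on \<Gamma>\<^sub>0"
    by (rule finite_nonzero_values_imp_summable_on, rule finite_subset[of _ ?B]) (use zero in auto)
  then show ?thesis by (auto simp: ell2_def psi_outside)
qed

text \<open>The Gram operator of the functions \<open>\<psi> m\<close>: it is \<open>6 (1 - P)\<close> with \<open>P\<close> the transition operator.\<close>

lemma inner_curl_psi:
  "ell2_inner \<Gamma>\<^sub>0 (curl \<phi>) (\<psi> m) = 6 * \<phi> m - (\<Sum>t\<in>neighbours. \<phi> (m + t))"
proof -
  have ss: "s * s = 1" using sign by auto
  have "ell2_inner \<Gamma>\<^sub>0 (curl \<phi>) (\<psi> m) = (s * s) * (6 * \<phi> m - (\<Sum>t\<in>neighbours. \<phi> (m + t)))"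
    unfolding inner_psi curl_edge0 curl_edge1 curl_edge2 sum_neighbours
    by (cases m) (simp add: algebra_simps)
  then show ?thesis using ss by simp
qed

text \<open>An element of \<open>E6\<close> orthogonal to all \<open>\<psi> m\<close> satisfies three linear relations between its values
  on the three classes of edges; eliminating two of the classes leaves a harmonic function.\<close>

lemma E6_orthogonal_psi:
  assumes v: "v \<in> E6" and orth: "\<And>m. ell2_inner \<Gamma>\<^sub>0 v (\<psi> m) = 0"
  shows "v = (\<lambda>x. 0)"
proof -
  have v2: "v \<in> ell2 \<Gamma>\<^sub>0" using v E6_subset by blast
  define a where "a n = v (edge1 n)" for n
  define b where "b n = v (edge2 n)" for n
  have c: "v (edge0 n) = - a n - b n" for n
  proof -
    have "v (edge0 n) + (a n + b n) = 0"
      using E6_vertex_sums(1)[OF v, of n] unfolding up_sum_def a_def b_def by (simp add: add.assoc)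
    then have "v (edge0 n) = - (a n + b n)" by (rule eq_neg_iff_add_eq_0[THEN iffD2])
    then show ?thesis by simp
  qed
  have ab: "b (n + (0,1)) = a n + b n - a (n + (1,0))" for n
  proof -
    have "- a n - b n + a (n + (1,0)) + b (n + (0,1)) = 0"
      using E6_vertex_sums(2)[OF v, of n] unfolding down_sum_def c by (simp add: a_def b_def)
    then have "b (n + (0,1)) - (a n + b n - a (n + (1,0))) = 0" by (simp add: algebra_simps)
    then show ?thesis by simp
  qed
  have h: "a n - 2 * a (n - (0,1)) + a (n - (1,0)) - b n + 2 * b (n - (1,0)) - b (n - (0,1)) = 0" for n
  proof -
    have "s \<noteq> 0" using sign by auto
    then have "a n - a (n - (0,1)) - b n + b (n - (1,0)) - (- a (n - (1,0)) - b (n - (1,0)))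
      + (- a (n - (0,1)) - b (n - (0,1))) = 0"
      using orth[of n] unfolding inner_psi c by (simp add: a_def b_def)
    then show ?thesis by (simp add: algebra_simps)
  qed
  \<comment> \<open>Subtract \<open>h\<close> at \<open>n\<close> from \<open>h\<close> at \<open>n + (0,1)\<close>; only differences of \<open>b\<close> in direction \<open>(0,1)\<close> remain,
    and \<open>ab\<close> replaces them by values of \<open>a\<close>.\<close>
  have harm: "6 * a n = (\<Sum>t\<in>neighbours. a (n + t))" for n
  proof -
    obtain j k where n: "n = (j, k)" by force
    have b1: "b (j, k + 1) = a (j, k) + b (j, k) - a (j + 1, k)" for j k
      using ab[of "(j, k)"] by simp
    have "a (j, k + 1) - 2 * a (j, k) + a (j - 1, k + 1)
        - b (j, k + 1) + 2 * b (j - 1, k + 1) - b (j, k) = 0"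
      using h[of "(j, k + 1)"] by simp
    then have h1: "a (j, k + 1) - 2 * a (j, k) + a (j - 1, k + 1)
        - (a (j, k) + b (j, k) - a (j + 1, k)) + 2 * (a (j - 1, k) + b (j - 1, k) - a (j, k)) - b (j, k) = 0"
      unfolding b1 by simp
    have b2: "b (j, k) = a (j, k - 1) + b (j, k - 1) - a (j + 1, k - 1)"
      using ab[of "(j, k - 1)"] by simp
    have h2: "a (j, k) - 2 * a (j, k - 1) + a (j - 1, k) - b (j, k) + 2 * b (j - 1, k) - b (j, k - 1) = 0"
      using h[of "(j, k)"] by simp
    have "6 * a (j, k) - (a (j + 1, k) + a (j - 1, k) + a (j, k + 1) + a (j, k - 1) + a (j + 1, k - 1) + a (j - 1, k + 1))
      = - (a (j, k + 1) - 2 * a (j, k) + a (j - 1, k + 1)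
        - (a (j, k) + b (j, k) - a (j + 1, k)) + 2 * (a (j - 1, k) + b (j - 1, k) - a (j, k)) - b (j, k))
      + (a (j, k) - 2 * a (j, k - 1) + a (j - 1, k) - b (j, k) + 2 * b (j - 1, k) - b (j, k - 1))
      - (b (j, k) - (a (j, k - 1) + b (j, k - 1) - a (j + 1, k - 1)))"
      by (simp add: algebra_simps)
    also have "\<dots> = 0" unfolding h1 h2 by (simp add: b2)
    finally show ?thesis by (simp add: sum_neighbours n)
  qed
  have fin: "finite {n. \<epsilon> \<le> cmod (a n)}" if "\<epsilon> > 0" for \<epsilon>
  proof -
    have "finite (edge1 -` {x. \<epsilon> \<le> cmod (v x)})"
      using ell2_finite_large[OF v2 that] by (intro finite_vimageI) (auto simp: inj_def)
    then show ?thesis by (simp add: a_def vimage_def)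
  qed
  have a0: "a n = 0" for n
    by (rule harmonic_vanishing_at_infinity[OF harm fin])
  have b0: "b n = 0" for n
  proof -
    have const: "b (n + (0, int k)) = b n" for k
    proof (induction k)
      case (Suc k)
      have "n + (0, int (Suc k)) = n + (0, int k) + (0,1)" by (simp add: prod_eq_iff)
      moreover have "b (n + (0, int k) + (0,1)) = b (n + (0, int k))"
        using ab[of "n + (0, int k)"] by (simp add: a0)
      ultimately show ?case using Suc by (simp only:)
    qed (simp add: zero_prod_def[symmetric])
    have "(\<lambda>k. b (n + (0, int k))) \<longlonglongrightarrow> 0"
      unfolding b_def by (rule ell2_tendsto_0[OF v2]) (auto simp: inj_def)
    then show ?thesis unfolding const by (simp add: LIMSEQ_const_iff)
  qed
  show ?thesis
  proof
    fix x
    show "v x = 0"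
    proof (cases "x \<in> \<Gamma>\<^sub>0")
      case True
      then show ?thesis
        by (cases x rule: edge_cases) (use a0 b0 c in \<open>auto simp: a_def b_def\<close>)
    qed (rule ell2_outside[OF v2])
  qed
qed

end

section \<open>The orthonormal system\<close>

lemma finite_neighbours [simp]: "finite neighbours"
  by (simp add: neighbours_def)

lemma card_neighbours [simp]: "card neighbours = 6"
  by (simp add: neighbours_def)

context hexagon_functions
begin

definition walk_curl :: "nat \<Rightarrow> int \<times> int \<Rightarrow> hex_vertex set \<Rightarrow> complex" where
  "walk_curl n p = curl (\<lambda>m. of_real (walk n (m + p)))"

lemma walk_curl_0: "walk_curl 0 p = \<psi> (- p)"
proof
  fix x
  have "((\<lambda>m. complex_of_real (walk 0 (m + p)) * \<psi> m x) has_sum \<psi> (- p) x) UNIV"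
    by (rule has_sum_finite_neutralI[of "{- p}"]) (auto simp: add_eq_0_iff2)
  then show "walk_curl 0 p x = \<psi> (- p) x" by (simp add: walk_curl_def curl_def infsumI)
qed

lemma walk_curl_Suc: "walk_curl (Suc n) p x = (\<Sum>t\<in>neighbours. (1/6) * walk_curl n (p + t) x)"
proof -
  obtain \<sigma> :: real and a b where \<sigma>: "\<And>\<phi>. curl \<phi> x = of_real \<sigma> * (\<phi> a - \<phi> b)"
    using curl_two_point[of x] by metis
  show ?thesis
    unfolding walk_curl_def \<sigma> walk.simps of_real_divide of_real_sum sum_distrib_left[symmetric] sum_subtractf
    by (simp add: add.assoc right_diff_distrib)
qed

lemma walk_curl_ell2: "walk_curl n p \<in> ell2 \<Gamma>\<^sub>0"
proof (induction n arbitrary: p)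
  case 0
  then show ?case by (simp add: walk_curl_0 psi_ell2)
next
  case (Suc n)
  have "walk_curl (Suc n) p = (\<lambda>x. \<Sum>t\<in>neighbours. (1/6) * walk_curl n (p + t) x)"
    by (simp add: walk_curl_Suc fun_eq_iff)
  then show ?case
    using ell2_sum[THEN conjunct1, of neighbours "\<lambda>t. walk_curl n (p + t)" "\<Gamma>\<^sub>0" "\<lambda>_. 1/6"] Suc
    by simp
qed

text \<open>A step of the walk in the second factor is an average over neighbouring indices and can be moved
  to the first factor, so only \<open>k = 0\<close>, the Gram operator, has to be computed.\<close>

lemma inner_walk_curl:
  "ell2_inner \<Gamma>\<^sub>0 (walk_curl n p) (walk_curl k q) =
     of_real (6 * (walk (n + k) (p - q) - walk (Suc (n + k)) (p - q)))"
proof (induction k arbitrary: q)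
  case 0
  have "(\<Sum>t\<in>neighbours. complex_of_real (walk n (- q + t + p))) = of_real (6 * walk (Suc n) (p - q))"
  proof -
    have "- q + t + p = p - q + t" for t by simp
    then show ?thesis by (simp only: walk.simps) (simp del: walk.simps)
  qed
  then show ?case
    unfolding walk_curl_0 unfolding walk_curl_def inner_curl_psi
    by (simp add: right_diff_distrib del: walk.simps) 
next
  case (Suc k)
  let ?g = "\<lambda>t. walk (n + k) (p - q + t) - walk (Suc (n + k)) (p - q + t)"
  have eq: "walk_curl (Suc k) q = (\<lambda>x. \<Sum>t\<in>neighbours. (1/6) * walk_curl k (q + t) x)"
    by (simp add: walk_curl_Suc fun_eq_iff)
  have "ell2_inner \<Gamma>\<^sub>0 (walk_curl n p) (walk_curl (Suc k) q)
      = (\<Sum>t\<in>neighbours. cnj (1/6) * ell2_inner \<Gamma>\<^sub>0 (walk_curl n p) (walk_curl k (q + t)))"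
    unfolding eq by (rule ell2_inner_sum_right) (auto simp: neighbours_def walk_curl_ell2)
  also have "\<dots> = (\<Sum>t\<in>neighbours. of_real (?g (- t)))"
    unfolding Suc by (simp add: algebra_simps del: walk.simps)
  also have "\<dots> = (\<Sum>t\<in>neighbours. of_real (?g t))"
    by (rule sum_neighbours_uminus[of "\<lambda>t. complex_of_real (?g t)"])
  also have "\<dots> = of_real (6 * (walk (Suc (n + k)) (p - q) - walk (Suc (Suc (n + k))) (p - q)))"
    by (simp only: walk.simps(2)[of "n + k" "p - q"] walk.simps(2)[of "Suc (n + k)" "p - q"])
       (simp add: sum_subtractf del: walk.simps)
  finally show ?case by (simp del: walk.simps)
qed

end

text \<open>The context fixes a function \<open>f\<close> with \<open>sqrt 6 \<cdot> f = (1 - P)\<^sup>-\<^sup>1\<^sup>/\<^sup>2 \<delta>\<^sub>0\<close>, where \<open>P\<close> is the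
  transition operator of the random walk.\<close>

locale walk_potential = hexagon_functions +
  fixes f :: "int \<times> int \<Rightarrow> real"
  assumes potential: "(\<lambda>n. inv_sqrt_coeff n * walk n m) sums (sqrt 6 * f m)"
begin

definition basis :: "int \<times> int \<Rightarrow> hex_vertex set \<Rightarrow> complex" where
  "basis p = curl (\<lambda>m. of_real (f (m + p)))"

definition partial_basis :: "nat \<Rightarrow> int \<times> int \<Rightarrow> hex_vertex set \<Rightarrow> complex" where
  "partial_basis N p x = (\<Sum>n\<le>N. of_real (inv_sqrt_coeff n / sqrt 6) * walk_curl n p x)"

lemma summable_walk: "summable (\<lambda>n. inv_sqrt_coeff n * walk n m)"
  using potential by (rule sums_summable)

lemma partial_basis_tendsto: "(\<lambda>N. partial_basis N p x) \<longlonglongrightarrow> basis p x"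
proof -
  obtain \<sigma> :: real and a b where \<sigma>: "\<And>\<phi>. curl \<phi> x = of_real \<sigma> * (\<phi> a - \<phi> b)"
    using curl_two_point[of x] by metis
  have "(\<lambda>n. \<sigma> / sqrt 6 * (inv_sqrt_coeff n * walk n (a + p) - inv_sqrt_coeff n * walk n (b + p)))
      sums (\<sigma> / sqrt 6 * (sqrt 6 * f (a + p) - sqrt 6 * f (b + p)))"
    by (intro sums_mult sums_diff potential)
  then have "(\<lambda>n. complex_of_real (\<sigma> / sqrt 6 * (inv_sqrt_coeff n * walk n (a + p) - inv_sqrt_coeff n * walk n (b + p))))
      sums of_real (\<sigma> / sqrt 6 * (sqrt 6 * f (a + p) - sqrt 6 * f (b + p)))"
    by (rule sums_of_real)
  moreover have "complex_of_real (\<sigma> / sqrt 6 * (inv_sqrt_coeff n * walk n (a + p) - inv_sqrt_coeff n * walk n (b + p)))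
      = of_real (inv_sqrt_coeff n / sqrt 6) * walk_curl n p x" for n
    unfolding walk_curl_def \<sigma> of_real_mult[symmetric] of_real_diff[symmetric] of_real_eq_iff
    by (simp add: right_diff_distrib mult_ac)
  moreover have "of_real (\<sigma> / sqrt 6 * (sqrt 6 * f (a + p) - sqrt 6 * f (b + p))) = basis p x"
    unfolding basis_def \<sigma> right_diff_distrib[symmetric] by simp
  ultimately show ?thesis
    unfolding partial_basis_def sums_def_le by simp
qed

lemma partial_basis_ell2: "partial_basis N p \<in> ell2 \<Gamma>\<^sub>0"
  unfolding partial_basis_def[abs_def]
  by (rule ell2_sum[THEN conjunct1]) (auto simp: walk_curl_ell2)

text \<open>The Gram matrix of the functions \<open>walk_curl n p\<close> depends on \<open>n + k\<close> alone, so the norm is the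
  quadratic form of the truncated series of \<open>1 / sqrt (1 - x)\<close>.\<close>

lemma partial_basis_norm_le_1: "ell2_norm \<Gamma>\<^sub>0 (partial_basis N p) \<le> 1"
proof -
  let ?c = "\<lambda>n. complex_of_real (inv_sqrt_coeff n / sqrt 6)"
  have "of_real ((ell2_norm \<Gamma>\<^sub>0 (partial_basis N p))\<^sup>2) = ell2_inner \<Gamma>\<^sub>0 (partial_basis N p) (partial_basis N p)"
    by (rule ell2_inner_self[OF partial_basis_ell2, symmetric])
  also have "\<dots> = (\<Sum>n\<le>N. ?c n * ell2_inner \<Gamma>\<^sub>0 (walk_curl n p) (partial_basis N p))"
    by (subst (1) partial_basis_def[abs_def])
       (rule ell2_inner_sum_left, auto simp: walk_curl_ell2 partial_basis_ell2)
  also have "\<dots> = (\<Sum>n\<le>N. ?c n * (\<Sum>k\<le>N. cnj (?c k) * ell2_inner \<Gamma>\<^sub>0 (walk_curl n p) (walk_curl k p)))"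
    by (subst partial_basis_def[abs_def], subst ell2_inner_sum_right) (auto simp: walk_curl_ell2)
  also have "\<dots> = of_real (\<Sum>n\<le>N. \<Sum>k\<le>N. inv_sqrt_coeff n * inv_sqrt_coeff k * (walk (n + k) 0 - walk (Suc (n + k)) 0))"
    unfolding inner_walk_curl of_real_sum sum_distrib_left
  proof (intro sum.cong refl)
    fix n k
    have "inv_sqrt_coeff n / sqrt 6 * (inv_sqrt_coeff k / sqrt 6 * (6 * y)) = inv_sqrt_coeff n * inv_sqrt_coeff k * y" for y
    proof -
      have "inv_sqrt_coeff n / sqrt 6 * (inv_sqrt_coeff k / sqrt 6 * (6 * y))
        = inv_sqrt_coeff n * inv_sqrt_coeff k * y * (6 / (sqrt 6 * sqrt 6))" by simp
      then show ?thesis by simp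
    qed
    then show "?c n * (cnj (?c k) * complex_of_real (6 * (walk (n + k) (p - p) - walk (Suc (n + k)) (p - p))))
      = of_real (inv_sqrt_coeff n * inv_sqrt_coeff k * (walk (n + k) 0 - walk (Suc (n + k)) 0))"
      unfolding complex_cnj_complex_of_real of_real_mult[symmetric] of_real_eq_iff diff_self .
  qed
  finally have "(ell2_norm \<Gamma>\<^sub>0 (partial_basis N p))\<^sup>2 =
      (\<Sum>n\<le>N. \<Sum>k\<le>N. inv_sqrt_coeff n * inv_sqrt_coeff k * (walk (n + k) 0 - walk (Suc (n + k)) 0))"
    by (simp only: of_real_eq_iff)
  also have "\<dots> \<le> walk 0 0"
    by (rule inv_sqrt_coeff_quadratic_form_le[of "\<lambda>n. walk n 0"]) (rule walk_nonneg)
  finally show ?thesis using ell2_norm_nonneg[of "\<Gamma>\<^sub>0" "partial_basis N p"] by (simp add: power_le_one_iff)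
qed

lemma partial_basis_bound:
  "\<forall>\<^sub>F N in sequentially. partial_basis N p \<in> ell2 \<Gamma>\<^sub>0 \<and> ell2_norm \<Gamma>\<^sub>0 (partial_basis N p) \<le> 1"
  by (simp add: partial_basis_ell2 partial_basis_norm_le_1)

text \<open>Square summability of \<open>basis p\<close> comes from the uniform bound for its partial sums, since \<open>f\<close>
  itself is not square summable.\<close>

lemma basis_ell2: "basis p \<in> ell2 \<Gamma>\<^sub>0"
  by (rule ell2_pointwise_limit[OF _ partial_basis_bound partial_basis_tendsto]) simp

lemma basis_norm_le_1: "ell2_norm \<Gamma>\<^sub>0 (basis p) \<le> 1"
  by (rule ell2_norm_pointwise_limit[OF _ partial_basis_bound partial_basis_tendsto]) simp

lemma basis_E6: "basis p \<in> E6"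
  using basis_ell2 unfolding basis_def by (rule curl_eigen)

lemma basis_real: "cnj (basis p x) = basis p x"
proof -
  obtain \<sigma> :: real and a b where "\<And>\<phi>. curl \<phi> x = of_real \<sigma> * (\<phi> a - \<phi> b)"
    using curl_two_point[of x] by metis
  then show ?thesis by (simp add: basis_def)
qed

text \<open>Summation by parts turns the increments of \<open>n \<mapsto> walk n\<close> into the coefficients of
  \<open>sqrt (1 - x)\<close>; the boundary terms vanish in the limit.\<close>

lemma inner_basis_walk_curl:
  assumes A: "(\<lambda>n. sqrt_coeff n * walk (k + n) (p - q)) sums A"
  shows "ell2_inner \<Gamma>\<^sub>0 (basis p) (walk_curl k q) = of_real (sqrt 6 * A)"
proof (rule LIMSEQ_unique)
  let ?a = "\<lambda>n. walk (k + n) (p - q)"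
  show "(\<lambda>N. ell2_inner \<Gamma>\<^sub>0 (partial_basis N p) (walk_curl k q)) \<longlonglongrightarrow> ell2_inner \<Gamma>\<^sub>0 (basis p) (walk_curl k q)"
    by (rule ell2_weak_limit[OF partial_basis_bound partial_basis_tendsto basis_ell2 walk_curl_ell2])
  have inner: "ell2_inner \<Gamma>\<^sub>0 (partial_basis N p) (walk_curl k q)
      = of_real (sqrt 6 * ((\<Sum>n\<le>N. sqrt_coeff n * ?a n) - inv_sqrt_coeff N * ?a (Suc N)))" for N
  proof -
    have "ell2_inner \<Gamma>\<^sub>0 (partial_basis N p) (walk_curl k q)
        = (\<Sum>n\<le>N. of_real (inv_sqrt_coeff n / sqrt 6) * ell2_inner \<Gamma>\<^sub>0 (walk_curl n p) (walk_curl k q))"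
      unfolding partial_basis_def[abs_def]
      by (rule ell2_inner_sum_left) (auto simp: walk_curl_ell2)
    also have "\<dots> = (\<Sum>n\<le>N. of_real (sqrt 6 * (inv_sqrt_coeff n * (?a n - ?a (Suc n)))))"
    proof (intro sum.cong refl)
      fix n
      have "c / sqrt 6 * (6 * y) = sqrt 6 * (c * y)" for c y :: real
      proof -
        have "c / sqrt 6 * (6 * y) = 6 / sqrt 6 * (c * y)" by simp
        also have "6 / sqrt 6 = sqrt 6" by (rule real_div_sqrt) simp
        finally show ?thesis .
      qed
      then show "complex_of_real (inv_sqrt_coeff n / sqrt 6) * ell2_inner \<Gamma>\<^sub>0 (walk_curl n p) (walk_curl k q)
          = of_real (sqrt 6 * (inv_sqrt_coeff n * (?a n - ?a (Suc n))))"
        unfolding inner_walk_curl of_real_mult[symmetric] of_real_eq_iff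
        by (simp only: add.commute[of n k] add_Suc_right)
    qed
    also have "\<dots> = of_real (sqrt 6 * (\<Sum>n\<le>N. inv_sqrt_coeff n * (?a n - ?a (Suc n))))"
      unfolding sum_distrib_left of_real_sum ..
    finally show ?thesis unfolding inv_sqrt_coeff_summation_by_parts[of ?a N] .
  qed
  obtain B where "\<forall>k. (\<lambda>n. inv_sqrt_coeff n * walk (n + k) (p - q)) sums B k"
    using coeff_sums_swapped[of "\<lambda>n. walk n (p - q)"] walk_nonneg summable_walk by blast
  then have "(\<lambda>n. inv_sqrt_coeff n * walk (n + Suc k) (p - q)) \<longlonglongrightarrow> 0"
    using sums_summable summable_LIMSEQ_zero by blast
  then have boundary: "(\<lambda>N. inv_sqrt_coeff N * ?a (Suc N)) \<longlonglongrightarrow> 0"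
    by (simp add: add.commute del: walk.simps)
  have main: "(\<lambda>N. \<Sum>n\<le>N. sqrt_coeff n * ?a n) \<longlonglongrightarrow> A"
    using A by (simp add: sums_def_le)
  have "(\<lambda>N. complex_of_real (sqrt 6 * ((\<Sum>n\<le>N. sqrt_coeff n * ?a n) - inv_sqrt_coeff N * ?a (Suc N))))
      \<longlonglongrightarrow> of_real (sqrt 6 * (A - 0))"
    by (intro tendsto_intros main boundary)
  then show "(\<lambda>N. ell2_inner \<Gamma>\<^sub>0 (partial_basis N p) (walk_curl k q)) \<longlonglongrightarrow> of_real (sqrt 6 * A)"
    unfolding inner by simp
qed

text \<open>Taking the limit in the second argument as well leaves the double series of \<open>coeff_has_sum\<close> for
  \<open>a n = walk n (q - p)\<close>, whose value is \<open>walk 0 (q - p)\<close>.\<close>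

lemma basis_orthonormal: "ell2_inner \<Gamma>\<^sub>0 (basis p) (basis q) = (if p = q then 1 else 0)"
proof -
  let ?a = "\<lambda>n. walk n (q - p)"
  obtain A where A: "\<And>k. (\<lambda>n. sqrt_coeff n * ?a (k + n)) sums A k"
    and sum: "(\<lambda>k. inv_sqrt_coeff k * A k) sums ?a 0"
    using coeff_sums[of ?a] walk_nonneg summable_walk by blast
  have "ell2_inner \<Gamma>\<^sub>0 (partial_basis N p) (basis q) = of_real (\<Sum>k\<le>N. inv_sqrt_coeff k * A k)" for N
  proof -
    have "ell2_inner \<Gamma>\<^sub>0 (walk_curl k p) (basis q) = of_real (sqrt 6 * A k)" for k
      by (subst ell2_inner_commute) (simp only: inner_basis_walk_curl[OF A] complex_cnj_complex_of_real)
    then have "ell2_inner \<Gamma>\<^sub>0 (partial_basis N p) (basis q)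
        = (\<Sum>k\<le>N. of_real (inv_sqrt_coeff k / sqrt 6) * of_real (sqrt 6 * A k))"
      unfolding partial_basis_def[abs_def]
      by (subst ell2_inner_sum_left) (auto simp: walk_curl_ell2 basis_ell2)
    also have "\<dots> = (\<Sum>k\<le>N. of_real (inv_sqrt_coeff k * A k))"
      by (intro sum.cong refl) simp
    finally show ?thesis by simp
  qed
  moreover have "(\<lambda>N. ell2_inner \<Gamma>\<^sub>0 (partial_basis N p) (basis q)) \<longlonglongrightarrow> ell2_inner \<Gamma>\<^sub>0 (basis p) (basis q)"
    by (rule ell2_weak_limit[OF partial_basis_bound partial_basis_tendsto basis_ell2 basis_ell2])
  moreover have "(\<lambda>N. complex_of_real (\<Sum>k\<le>N. inv_sqrt_coeff k * A k)) \<longlonglongrightarrow> of_real (?a 0)"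
    using sum unfolding sums_def_le by (rule tendsto_of_real)
  ultimately have "ell2_inner \<Gamma>\<^sub>0 (basis p) (basis q) = of_real (?a 0)"
    using LIMSEQ_unique by auto
  then show ?thesis by auto
qed

text \<open>Averaging the basis over \<open>k\<close> steps of the walk in the index stays inside the unit ball of the
  span, and weighting these averages by the coefficients of \<open>sqrt (1 - x)\<close> recovers \<open>\<psi>\<close>.\<close>

fun averaged_basis :: "nat \<Rightarrow> int \<times> int \<Rightarrow> hex_vertex set \<Rightarrow> complex" where
  "averaged_basis 0 p = basis p"
| "averaged_basis (Suc k) p = (\<lambda>x. \<Sum>t\<in>neighbours. (1/6) * averaged_basis k (p + t) x)"

lemma averaged_basis_ell2: "averaged_basis k p \<in> ell2 \<Gamma>\<^sub>0 \<and> ell2_norm \<Gamma>\<^sub>0 (averaged_basis k p) \<le> 1"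
proof (induction k arbitrary: p)
  case (Suc k)
  have "(\<Sum>t\<in>neighbours. cmod (1/6) * ell2_norm \<Gamma>\<^sub>0 (averaged_basis k (p + t))) \<le> (\<Sum>t\<in>neighbours. 1/6)"
    using Suc by (intro sum_mono) simp
  also have "\<dots> = 1" by simp
  finally show ?case
    using ell2_sum[of neighbours "\<lambda>t. averaged_basis k (p + t)" "\<Gamma>\<^sub>0" "\<lambda>_. 1/6"] Suc
    by simp
qed (simp add: basis_ell2 basis_norm_le_1)

text \<open>Averaging over the index commutes with the series defining the basis, so \<open>k\<close> steps of averaging
  shift the index of the transition kernels by \<open>k\<close>.\<close>

lemma averaged_basis_two_point:
  assumes \<sigma>: "\<And>\<phi>. curl \<phi> x = of_real \<sigma> * (\<phi> a - \<phi> b)"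
    and A: "\<And>p. (\<lambda>n. inv_sqrt_coeff n * walk (n + k) (a + p)) sums A p"
    and B: "\<And>p. (\<lambda>n. inv_sqrt_coeff n * walk (n + k) (b + p)) sums B p"
  shows "averaged_basis k p x = of_real (\<sigma> / sqrt 6 * (A p - B p))"
  using A B
proof (induction k arbitrary: p A B)
  case 0
  have "A p = sqrt 6 * f (a + p)" "B p = sqrt 6 * f (b + p)"
    using 0[of p] potential[of "a + p"] potential[of "b + p"] by (auto dest: sums_unique2)
  then show ?case by (simp add: basis_def \<sigma> right_diff_distrib)
next
  case (Suc k)
  define A' where "A' p = (\<Sum>n. inv_sqrt_coeff n * walk (n + k) (a + p))" for p
  define B' where "B' p = (\<Sum>n. inv_sqrt_coeff n * walk (n + k) (b + p))" for p
  have s: "(\<lambda>n. inv_sqrt_coeff n * walk (n + k) m) sums (\<Sum>n. inv_sqrt_coeff n * walk (n + k) m)" for m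
    using coeff_sums_swapped[of "\<lambda>n. walk n m"] walk_nonneg summable_walk
    by (blast intro: summable_sums sums_summable)
  have step: "(\<lambda>n. inv_sqrt_coeff n * walk (n + Suc k) (c + p)) sums
      ((\<Sum>t\<in>neighbours. (\<Sum>n. inv_sqrt_coeff n * walk (n + k) (c + (p + t)))) / 6)" for c
  proof -
    have "(\<lambda>n. (\<Sum>t\<in>neighbours. inv_sqrt_coeff n * walk (n + k) (c + (p + t))) / 6) sums
      ((\<Sum>t\<in>neighbours. (\<Sum>n. inv_sqrt_coeff n * walk (n + k) (c + (p + t)))) / 6)"
      by (intro sums_divide sums_sum s)
    then show ?thesis by (simp add: sum_distrib_left add.assoc)
  qed
  have "A p = (\<Sum>t\<in>neighbours. A' (p + t)) / 6" "B p = (\<Sum>t\<in>neighbours. B' (p + t)) / 6"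
    using Suc.prems[of p] step[of a] step[of b] unfolding A'_def B'_def by (auto dest: sums_unique2)
  moreover have "(\<Sum>t\<in>neighbours. 1/6 * (c * (A' (p + t) - B' (p + t))))
      = c * ((\<Sum>t\<in>neighbours. A' (p + t)) / 6 - (\<Sum>t\<in>neighbours. B' (p + t)) / 6)" for c
    unfolding sum_distrib_left[symmetric] sum_subtractf by (simp add: right_diff_distrib)
  ultimately have "of_real (\<sigma> / sqrt 6 * (A p - B p))
      = complex_of_real (\<Sum>t\<in>neighbours. 1/6 * (\<sigma> / sqrt 6 * (A' (p + t) - B' (p + t))))"
    by (simp only:)
  moreover have "averaged_basis k p x = of_real (\<sigma> / sqrt 6 * (A' p - B' p))" for p
    unfolding A'_def B'_def by (rule Suc.IH) (rule s)+
  ultimately show ?case by (simp add: mult_ac)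
qed

lemma weighted_averages_tendsto:
  "(\<lambda>K. \<Sum>k<K. of_real (sqrt_coeff k) * averaged_basis k p x) \<longlonglongrightarrow> \<psi> (- p) x / of_real (sqrt 6)"
proof -
  obtain \<sigma> :: real and a b where \<sigma>: "\<And>\<phi>. curl \<phi> x = of_real \<sigma> * (\<phi> a - \<phi> b)"
    using curl_two_point[of x] by metis
  define S where "S k m = (\<Sum>n. inv_sqrt_coeff n * walk (n + k) m)" for k m
  have S: "(\<lambda>n. inv_sqrt_coeff n * walk (n + k) m) sums S k m"
    and lim: "(\<lambda>k. sqrt_coeff k * S k m) sums walk 0 m" for k m
  proof -
    obtain B where B: "\<forall>k. (\<lambda>n. inv_sqrt_coeff n * walk (n + k) m) sums B k"
      "(\<lambda>k. sqrt_coeff k * B k) sums walk 0 m"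
      using coeff_sums_swapped[of "\<lambda>n. walk n m"] walk_nonneg summable_walk by blast
    have "S k m = B k" for k using B(1) by (simp add: S_def sums_iff)
    then show "(\<lambda>n. inv_sqrt_coeff n * walk (n + k) m) sums S k m"
      "(\<lambda>k. sqrt_coeff k * S k m) sums walk 0 m" using B by auto
  qed
  have av: "averaged_basis k p x = of_real (\<sigma> / sqrt 6 * (S k (a + p) - S k (b + p)))" for k
    by (rule averaged_basis_two_point[OF \<sigma> S S])
  have "(\<lambda>k. \<sigma> / sqrt 6 * (sqrt_coeff k * S k (a + p) - sqrt_coeff k * S k (b + p)))
      sums (\<sigma> / sqrt 6 * (walk 0 (a + p) - walk 0 (b + p)))"
    by (intro sums_mult sums_diff lim)
  then have "(\<lambda>k. complex_of_real (\<sigma> / sqrt 6 * (sqrt_coeff k * S k (a + p) - sqrt_coeff k * S k (b + p))))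
      sums of_real (\<sigma> / sqrt 6 * (walk 0 (a + p) - walk 0 (b + p)))"
    by (rule sums_of_real)
  moreover have "complex_of_real (\<sigma> / sqrt 6 * (sqrt_coeff k * S k (a + p) - sqrt_coeff k * S k (b + p)))
      = of_real (sqrt_coeff k) * averaged_basis k p x" for k
    unfolding av of_real_mult[symmetric] of_real_eq_iff by (simp add: right_diff_distrib mult_ac)
  moreover have "of_real (\<sigma> / sqrt 6 * (walk 0 (a + p) - walk 0 (b + p))) = \<psi> (- p) x / of_real (sqrt 6)"
    unfolding walk_curl_0[symmetric] walk_curl_def \<sigma> by simp
  ultimately show ?thesis by (simp add: sums_def)
qed

text \<open>Orthogonality to the basis passes to the averages and, their weighted sums being bounded in norm,
  to the pointwise limit \<open>\<psi> m / sqrt 6\<close>.\<close>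

lemma basis_total:
  assumes v: "v \<in> E6" and orth: "\<And>p. ell2_inner \<Gamma>\<^sub>0 v (basis p) = 0"
  shows "v = (\<lambda>x. 0)"
proof (rule E6_orthogonal_psi[OF v])
  fix m
  have v2: "v \<in> ell2 \<Gamma>\<^sub>0" using v E6_subset by blast
  have av: "ell2_inner \<Gamma>\<^sub>0 (averaged_basis k p) v = 0" for k p
  proof (induction k arbitrary: p)
    case 0
    then show ?case using orth[of p] ell2_inner_commute[of "\<Gamma>\<^sub>0" "basis p" v] by simp
  next
    case (Suc k)
    have "ell2_inner \<Gamma>\<^sub>0 (averaged_basis (Suc k) p) v
        = (\<Sum>t\<in>neighbours. (1/6) * ell2_inner \<Gamma>\<^sub>0 (averaged_basis k (p + t)) v)"
      unfolding averaged_basis.simps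
      by (rule ell2_inner_sum_left) (auto simp: neighbours_def averaged_basis_ell2 v2)
    then show ?case using Suc by simp
  qed
  let ?t = "\<lambda>K x. \<Sum>k<K. of_real (sqrt_coeff k) * averaged_basis k (- m) x"
  have bound: "\<forall>\<^sub>F K in sequentially. ?t K \<in> ell2 \<Gamma>\<^sub>0 \<and> ell2_norm \<Gamma>\<^sub>0 (?t K) \<le> 2"
  proof (rule always_eventually, rule allI)
    fix K
    have *: "?t K \<in> ell2 \<Gamma>\<^sub>0 \<and> ell2_norm \<Gamma>\<^sub>0 (?t K)
        \<le> (\<Sum>k<K. cmod (of_real (sqrt_coeff k)) * ell2_norm \<Gamma>\<^sub>0 (averaged_basis k (- m)))"
      by (rule ell2_sum) (auto simp: averaged_basis_ell2)
    have "(\<Sum>k<K. cmod (of_real (sqrt_coeff k)) * ell2_norm \<Gamma>\<^sub>0 (averaged_basis k (- m)))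
        \<le> (\<Sum>k<K. \<bar>sqrt_coeff k\<bar>)"
      by (intro sum_mono) (auto intro!: mult_left_le averaged_basis_ell2[THEN conjunct2])
    also have "\<dots> \<le> 2" by (rule sum_sqrt_coeff_abs)
    finally show "?t K \<in> ell2 \<Gamma>\<^sub>0 \<and> ell2_norm \<Gamma>\<^sub>0 (?t K) \<le> 2" using * by auto
  qed
  let ?w = "\<lambda>x. (1 / of_real (sqrt 6)) * \<psi> m x"
  have lim: "(\<lambda>K. ?t K x) \<longlonglongrightarrow> ?w x" for x
    using weighted_averages_tendsto[of "- m" x] by simp
  have "(\<lambda>K. ell2_inner \<Gamma>\<^sub>0 (?t K) v) \<longlonglongrightarrow> ell2_inner \<Gamma>\<^sub>0 ?w v"
    by (rule ell2_weak_limit[OF bound lim ell2_scale[OF psi_ell2] v2])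
  moreover have "ell2_inner \<Gamma>\<^sub>0 (?t K) v = 0" for K
    by (subst ell2_inner_sum_left) (auto simp: averaged_basis_ell2 v2 av)
  ultimately have "ell2_inner \<Gamma>\<^sub>0 ?w v = 0" by (simp add: LIMSEQ_const_iff)
  then have "ell2_inner \<Gamma>\<^sub>0 (\<psi> m) v = 0" unfolding ell2_inner_scale_left by simp
  then show "ell2_inner \<Gamma>\<^sub>0 v (\<psi> m) = 0" using ell2_inner_commute[of "\<Gamma>\<^sub>0" v "\<psi> m"] by simp
qed

sublocale ell2_orthonormal "\<Gamma>\<^sub>0" basis
  by unfold_locales (rule basis_ell2 basis_orthonormal)+

theorem basis_of_E6:
  shows "ell2_orthonormal_basis \<Gamma>\<^sub>0 E6 basis"
    and "F \<in> ell2 \<Gamma>\<^sub>0 \<Longrightarrow> ((\<lambda>p. ell2_inner \<Gamma>\<^sub>0 F (basis p) * basis p x) has_sum ell2_proj \<Gamma>\<^sub>0 E6 F x) UNIV"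
proof -
  have closed: "w \<in> E6"
    if "\<And>S. finite S \<Longrightarrow> u S \<in> E6" "w \<in> ell2 \<Gamma>\<^sub>0"
      "\<And>x. ((\<lambda>S. u S x) \<longlongrightarrow> w x) (finite_subsets_at_top UNIV)"
    for u :: "(int \<times> int) set \<Rightarrow> hex_vertex set \<Rightarrow> complex" and w
    by (rule E6_pointwise_limit[OF _ _ that(2,3)])
       (auto intro: eventually_finite_subsets_at_top_weakI that(1))
  note * = E6_subset E6_diff E6_sum[OF _ basis_E6] closed basis_total
  show "ell2_orthonormal_basis \<Gamma>\<^sub>0 E6 basis"
    by (rule basis_and_projection(1)[OF *])
  show "((\<lambda>p. ell2_inner \<Gamma>\<^sub>0 F (basis p) * basis p x) has_sum ell2_proj \<Gamma>\<^sub>0 E6 F x) UNIV"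
    if "F \<in> ell2 \<Gamma>\<^sub>0"
    by (rule basis_and_projection(2)[OF * that])
qed

end

section \<open>The walk in Fourier space\<close>

text \<open>Points of the unit square are written \<open>(b, a)\<close>, with the variable of the outer integral first, so
  that Fubini's theorem turns integrals over the square into the iterated integrals of \<open>f_tilde\<close>.\<close>

definition character :: "int \<times> int \<Rightarrow> real \<times> real \<Rightarrow> complex" where
  "character m z = exp (2 * complex_of_real pi * \<i> *
     complex_of_real (snd z * real_of_int (fst m) + fst z * real_of_int (snd m)))"

text \<open>The symbol of the transition operator: one step of the walk multiplies a character by this number.\<close>

definition symbol :: "real \<times> real \<Rightarrow> real" where
  "symbol z = (cos (2 * pi * snd z) + cos (2 * pi * fst z) + cos (2 * pi * (snd z - fst z))) / 3"

definition square_integral :: "(real \<times> real \<Rightarrow> complex) \<Rightarrow> complex" where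
  "square_integral h = (LINT z:{0..1}\<times>{0..1}|lborel \<Otimes>\<^sub>M lborel. h z)"

abbreviation square_integrable :: "(real \<times> real \<Rightarrow> complex) \<Rightarrow> bool" where
  "square_integrable \<equiv> set_integrable (lborel \<Otimes>\<^sub>M lborel) ({0..1}\<times>{0..1})"

lemma character_add: "character (m + n) z = character m z * character n z"
  unfolding character_def exp_add[symmetric] by (simp add: algebra_simps)

lemma norm_character: "cmod (character m z) = 1"
proof -
  have "character m z = cis (2 * pi * (snd z * real_of_int (fst m) + fst z * real_of_int (snd m)))"
    unfolding character_def cis_conv_exp by (simp add: mult_ac)
  then show ?thesis by simp
qed

lemma sum_neighbours_character:
  "(\<Sum>t\<in>neighbours. character (m + t) z) = 6 * of_real (symbol z) * character m z"
proof -
  have pair: "character (j, k) z + character (-j, -k) z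
      = of_real (2 * cos (2 * pi * (snd z * real_of_int j + fst z * real_of_int k)))" for j k
  proof -
    have "character (j', k') z = cis (2 * pi * (snd z * real_of_int j' + fst z * real_of_int k'))" for j' k'
      unfolding character_def cis_conv_exp by (simp add: mult_ac)
    moreover have "cis x + cis (- x) = of_real (2 * cos x)" for x
      by (simp add: complex_eq_iff)
    moreover have "2 * pi * (snd z * real_of_int (- j) + fst z * real_of_int (- k))
        = - (2 * pi * (snd z * real_of_int j + fst z * real_of_int k))"
      by (simp add: algebra_simps)
    ultimately show ?thesis by metis
  qed
  have p: "character (1, 0) z + character (-1, 0) z = of_real (2 * cos (2 * pi * snd z))"
    "character (0, 1) z + character (0, -1) z = of_real (2 * cos (2 * pi * fst z))"
    "character (1, -1) z + character (-1, 1) z = of_real (2 * cos (2 * pi * (snd z - fst z)))"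
    using pair[of 1 0] pair[of 0 1] pair[of 1 "-1"] by simp_all
  have "(\<Sum>t\<in>neighbours. character t z) = (character (1, 0) z + character (-1, 0) z)
      + (character (0, 1) z + character (0, -1) z) + (character (1, -1) z + character (-1, 1) z)"
    by (simp add: sum_neighbours add_ac)
  also have "\<dots> = of_real (6 * symbol z)"
    unfolding p symbol_def by simp
  finally have "(\<Sum>t\<in>neighbours. character t z) = of_real (6 * symbol z)" .
  then show ?thesis
    unfolding character_add sum_distrib_left[symmetric] by (simp add: mult_ac)
qed

lemma character_measurable [measurable]: "character m \<in> borel_measurable (lborel \<Otimes>\<^sub>M lborel)"
proof -
  have "continuous_on UNIV (character m)"
    unfolding character_def[abs_def] by (intro continuous_intros)
  then show ?thesis by (simp add: lborel_prod borel_measurable_continuous_onI)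
qed

lemma symbol_measurable [measurable]: "symbol \<in> borel_measurable (lborel \<Otimes>\<^sub>M lborel)"
proof -
  have "continuous_on UNIV symbol"
    unfolding symbol_def[abs_def] by (intro continuous_intros) auto
  then show ?thesis by (simp add: lborel_prod borel_measurable_continuous_onI)
qed

lemma symbol_le_1: "symbol z \<le> 1"
proof -
  have "(x + y + w) / 3 \<le> 1" if "x \<le> 1" "y \<le> 1" "w \<le> 1" for x y w :: real
    using that by simp
  then show ?thesis unfolding symbol_def by (simp only: cos_le_one)
qed

text \<open>This is \<open>0 \<le> \<bar>1 + cis x + cis y\<bar>\<^sup>2\<close>.\<close>

lemma symbol_ge: "- 1/2 \<le> symbol z"
proof -
  let ?x = "2 * pi * snd z" and ?y = "2 * pi * fst z"
  have expand: "(1 + c + d)\<^sup>2 + (s + t)\<^sup>2 = 1 + (s\<^sup>2 + c\<^sup>2) + (t\<^sup>2 + d\<^sup>2) + 2 * (c + d + (c * d + s * t))"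
    for c d s t :: real
    by (simp add: power2_eq_square algebra_simps)
  have diff: "cos (2 * pi * (snd z - fst z)) = cos ?x * cos ?y + sin ?x * sin ?y"
    by (simp add: right_diff_distrib cos_diff)
  have "(1 + cos ?x + cos ?y)\<^sup>2 + (sin ?x + sin ?y)\<^sup>2 = 3 + 6 * symbol z"
    unfolding expand sin_cos_squared_add symbol_def diff by simp
  then show ?thesis
    using zero_le_power2[of "1 + cos ?x + cos ?y"] zero_le_power2[of "sin ?x + sin ?y"] by linarith
qed

lemma abs_symbol_le_1: "\<bar>symbol z\<bar> \<le> 1"
  using symbol_ge[of z] symbol_le_1[of z] by linarith

lemma square_integrable_bounded:
  assumes "h \<in> borel_measurable (lborel \<Otimes>\<^sub>M lborel)" "\<And>z. cmod (h z) \<le> B"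
  shows "square_integrable h"
  unfolding set_integrable_def
proof (rule integrableI_bounded_set_indicator[where B=B])
  have "emeasure (lborel \<Otimes>\<^sub>M lborel) ({0..1::real} \<times> {0..1::real}) = 1"
    by (simp add: lborel.emeasure_pair_measure_Times)
  then show "emeasure (lborel \<Otimes>\<^sub>M lborel) ({0..1::real} \<times> {0..1::real}) < \<infinity>" by simp
qed (use assms in auto)

lemma square_integral_iterated:
  assumes "square_integrable h"
  shows "square_integral h = (LBINT b:{0..1}. (LBINT a:{0..1}. h (b, a)))"
proof -
  have "square_integral h = (\<integral>b. \<integral>a. indicator ({0..1} \<times> {0..1}) (b, a) *\<^sub>R h (b, a) \<partial>lborel \<partial>lborel)"
    unfolding square_integral_def set_lebesgue_integral_def
    by (rule lborel_pair.integral_fst'[symmetric]) (use assms in \<open>simp add: set_integrable_def\<close>)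
  also have "\<dots> = (LBINT b:{0..1}. (LBINT a:{0..1}. h (b, a)))"
    unfolding set_lebesgue_integral_def by (simp add: indicator_times scaleR_scaleR[symmetric] del: scaleR_scaleR)
  finally show ?thesis .
qed

lemma symbol_character_integrable: "square_integrable (\<lambda>z. of_real (symbol z ^ n) * character m z)"
proof (rule square_integrable_bounded[where B=1])
  show "(\<lambda>z. of_real (symbol z ^ n) * character m z) \<in> borel_measurable (lborel \<Otimes>\<^sub>M lborel)"
    by measurable
  show "cmod (of_real (symbol z ^ n) * character m z) \<le> 1" for z
    by (simp add: norm_mult norm_power norm_character abs_symbol_le_1 power_le_one)
qed

lemma integral_exp_integer:
  "(LBINT a:{0..1}. exp (2 * complex_of_real pi * \<i> * complex_of_real (a * real_of_int j))) = (if j = 0 then 1 else 0)"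
proof -
  let ?c = "2 * complex_of_real pi * \<i> * of_int j"
  have cont: "continuous_on {0..1} (\<lambda>a. exp (2 * complex_of_real pi * \<i> * complex_of_real (a * real_of_int j)))"
    by (intro continuous_intros)
  have "((\<lambda>a. exp (2 * complex_of_real pi * \<i> * complex_of_real (a * real_of_int j)))
      has_integral (if j = 0 then 1 else 0)) {0..1}"
  proof (cases "j = 0")
    case True
    then show ?thesis using has_integral_const_real[of "1::complex" 0 1] by simp
  next
    case False
    then have c: "?c \<noteq> 0" by simp
    have "((\<lambda>a. exp (2 * complex_of_real pi * \<i> * complex_of_real (a * real_of_int j)))
      has_integral (exp (?c * of_real 1) / ?c - exp (?c * of_real 0) / ?c)) {0..1}"
    proof (rule fundamental_theorem_of_calculus)
      fix a :: real
      have "((\<lambda>z. exp (?c * z) / ?c) has_field_derivative exp (?c * of_real a)) (at (of_real a))"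
        using c by (auto intro!: derivative_eq_intros)
      then have "((\<lambda>a. exp (?c * of_real a) / ?c) has_vector_derivative exp (?c * of_real a)) (at a within {0..1})"
        by (rule has_vector_derivative_real_field)
      then show "((\<lambda>a. exp (?c * of_real a) / ?c) has_vector_derivative
          exp (2 * complex_of_real pi * \<i> * complex_of_real (a * real_of_int j))) (at a within {0..1})"
        by (simp add: mult_ac)
    qed simp
    moreover have "exp ?c = 1"
      using exp_integer_2pi[of "of_int j"] by (simp add: mult_ac)
    ultimately show ?thesis using False by simp
  qed
  then have "integral {0..1} (\<lambda>a. exp (2 * complex_of_real pi * \<i> * complex_of_real (a * real_of_int j)))
      = (if j = 0 then 1 else 0)" by (rule integral_unique)
  then show ?thesis
    using set_borel_integral_eq_integral(2)[OF borel_integrable_atLeastAtMost'[OF cont]] by simp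
qed

text \<open>One step of the walk is multiplication by the symbol, and the Fourier coefficients of \<open>1\<close> are the
  point mass at \<open>0\<close>.\<close>

lemma walk_eq_integral: "square_integral (\<lambda>z. of_real (symbol z ^ n) * character m z) = of_real (walk n m)"
proof (induction n arbitrary: m)
  case 0
  obtain j k where m: "m = (j, k)" by force
  have split: "character m (b, a) = exp (2 * complex_of_real pi * \<i> * complex_of_real (b * real_of_int k)) *
      exp (2 * complex_of_real pi * \<i> * complex_of_real (a * real_of_int j))" for a b
    unfolding character_def m exp_add[symmetric] by (simp add: algebra_simps)
  have "square_integral (\<lambda>z. of_real (symbol z ^ 0) * character m z)
      = (LBINT b:{0..1}. (LBINT a:{0..1}. character m (b, a)))"
    by (subst square_integral_iterated[OF symbol_character_integrable]) simp
  also have "\<dots> = (if j = 0 then 1 else 0) * (if k = 0 then 1 else 0)"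
    unfolding split set_integral_mult_right set_integral_mult_left integral_exp_integer by simp
  also have "\<dots> = of_real (walk 0 m)"
    by (simp add: m zero_prod_def)
  finally show ?case .
next
  case (Suc n)
  have int: "square_integrable (\<lambda>z. of_real (symbol z ^ n) * character m z)" for m
    by (rule symbol_character_integrable)
  have "of_real (walk (Suc n) m) = (\<Sum>t\<in>neighbours. square_integral (\<lambda>z. of_real (symbol z ^ n) * character (m + t) z)) / 6"
    unfolding Suc by simp
  also have "\<dots> = square_integral (\<lambda>z. \<Sum>t\<in>neighbours. of_real (symbol z ^ n) * character (m + t) z) / 6"
    unfolding square_integral_def set_lebesgue_integral_def scaleR_sum_right
    by (subst Bochner_Integration.integral_sum) (use int in \<open>auto simp: set_integrable_def\<close>)
  also have "\<dots> = square_integral (\<lambda>z. 6 * (of_real (symbol z ^ Suc n) * character m z)) / 6"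
    unfolding sum_distrib_left[symmetric] sum_neighbours_character by (simp add: mult_ac)
  also have "\<dots> = square_integral (\<lambda>z. of_real (symbol z ^ Suc n) * character m z)"
    unfolding square_integral_def set_integral_mult_right by simp
  finally show ?case ..
qed

section \<open>The singular weight\<close>

text \<open>Concavity puts the sine above its chord on each half of the interval. The weaker bound by
  \<open>a * (1 - a)\<close> is stated because its inverse root is the integrand of the Beta function at
  \<open>(1/2, 1/2)\<close>, known to be integrable.\<close>

lemma sin_pi_ge:
  assumes "0 \<le> a" "a \<le> 1"
  shows "2 * (a * (1 - a)) \<le> sin (pi * a)"
proof -
  have concave: "concave_on {0..pi/2} sin"
    by (rule f''_le0_imp_concave[where f'=cos and f''="\<lambda>x. - sin x"])
       (auto intro!: derivative_eq_intros sin_ge_zero)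
  have half: "2 * t \<le> sin (pi * t)" if "0 \<le> t" "t \<le> 1/2" for t
    using concave_onD[OF concave, of "2 * t" 0 "pi/2"] that by (simp add: mult.commute)
  show ?thesis
  proof (cases "a \<le> 1/2")
    case True
    have "a * (1 - a) \<le> a" using assms by (simp add: mult_left_le)
    then show ?thesis using half[of a] True assms by linarith
  next
    case False
    have "sin (pi * (1 - a)) = sin (pi * a)" by (simp add: right_diff_distrib)
    then have "2 * (1 - a) \<le> sin (pi * a)" using half[of "1 - a"] False assms by simp
    moreover have "a * (1 - a) \<le> 1 - a" using assms by (simp add: mult_left_le_one_le)
    then have "2 * (a * (1 - a)) \<le> 2 * (1 - a)" by (rule mult_left_mono) simp
    ultimately show ?thesis by (rule order_trans[rotated])
  qed
qed

definition corner_weight :: "real \<Rightarrow> real" where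
  "corner_weight a = a powr (-1/2) * (1 - a) powr (-1/2)"

lemma corner_weight_integrable: "integrable lborel (\<lambda>a. indicator {0..1} a * corner_weight a)"
  using integrable_Beta[of "1/2" "1/2"] unfolding set_integrable_def corner_weight_def by simp

text \<open>The symbol equals \<open>1\<close> only at the corners of the square, where \<open>1 - symbol\<close> vanishes quadratically.
  A lower bound in product form suffices and makes the dominating function a product of functions of
  one variable. Negative values of the symbol stay above \<open>- 1/2\<close> and cause no singularity.\<close>

lemma one_minus_abs_symbol_ge:
  assumes a: "0 < a" "a < 1" and b: "0 < b" "b < 1"
  shows "a * (1 - a) * (b * (1 - b)) \<le> 1 - \<bar>symbol (b, a)\<bar>"
proof -
  define A where "A = a * (1 - a)"
  define B where "B = b * (1 - b)"
  have pos: "0 < A" "0 < B" using a b by (simp_all add: A_def B_def)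
  have c: "1 - cos (2 * pi * t) = 2 * (sin (pi * t))\<^sup>2" for t
    using cos_double_sin[of "pi * t"] by (simp add: mult_ac)
  have sA: "2 * A \<le> sin (pi * a)" and sB: "2 * B \<le> sin (pi * b)"
    using sin_pi_ge a b by (simp_all add: A_def B_def)
  have AB: "2 * A * (2 * B) \<le> sin (pi * a) * sin (pi * b)"
    using sA sB pos by (intro mult_mono) auto
  have "A * B \<le> 1 - \<bar>symbol (b, a)\<bar>"
  proof (cases "symbol (b, a) \<ge> 0")
    case True
    have "2 * (sin (pi * a) * sin (pi * b)) \<le> (sin (pi * a))\<^sup>2 + (sin (pi * b))\<^sup>2"
      using sum_squares_bound[of "sin (pi * a)" "sin (pi * b)"] by simp
    moreover have "2 * (sin (pi * a))\<^sup>2 + 2 * (sin (pi * b))\<^sup>2 \<le> 3 * (1 - symbol (b, a))"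
      using c[of a] c[of b] cos_le_one[of "2 * pi * (a - b)"] unfolding symbol_def fst_conv snd_conv
      by argo
    moreover have "A * B \<le> 1 - x"
      if "2 * p \<le> q" "2 * q \<le> 3 * (1 - x)" "2 * A * (2 * B) \<le> p" "x \<le> 1" for p q x
      using that by simp
    ultimately have "A * B \<le> 1 - symbol (b, a)"
      using AB symbol_le_1[of "(b, a)"] by (simp only: distrib_left[symmetric])
    then show ?thesis using True by simp
  next
    case False
    have "sin (pi * a) * sin (pi * b) \<le> 1 * 1"
      using sA sB pos by (intro mult_mono sin_le_one) auto
    then show ?thesis using AB False symbol_ge[of "(b, a)"] by linarith
  qed
  then show ?thesis by (simp add: A_def B_def)
qed

lemma open_square_AE:
  "AE z in lborel \<Otimes>\<^sub>M lborel. z \<in> {0..1::real} \<times> {0..1::real} \<longrightarrow> z \<in> {0<..<1} \<times> {0<..<1::real}"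
proof (rule lborel_pair.AE_pair_measure)
  have "AE x in lborel. x \<noteq> 0 \<and> x \<noteq> (1::real)"
    using AE_lborel_singleton[of "0::real"] AE_lborel_singleton[of "1::real"] by eventually_elim simp
  then show "AE b in lborel. AE a in lborel. (b, a) \<in> {0..1::real} \<times> {0..1::real} \<longrightarrow> (b, a) \<in> {0<..<1} \<times> {0<..<1::real}"
  proof eventually_elim
    case (elim b)
    have "AE x in lborel. x \<noteq> 0 \<and> x \<noteq> (1::real)"
      using AE_lborel_singleton[of "0::real"] AE_lborel_singleton[of "1::real"] by eventually_elim simp
    then show ?case by eventually_elim (use elim in auto)
  qed
qed measurable


lemma partial_series_le:
  assumes "\<bar>x\<bar> < 1"
  shows "\<bar>\<Sum>n<N. inv_sqrt_coeff n * x ^ n\<bar> \<le> 1 / sqrt (1 - \<bar>x\<bar>)"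
proof -
  have series: "(\<lambda>n. inv_sqrt_coeff n * \<bar>x\<bar> ^ n) sums (1 / sqrt (1 - \<bar>x\<bar>))"
    by (rule inv_sqrt_coeff_series) (use assms in simp)
  have "\<bar>\<Sum>n<N. inv_sqrt_coeff n * x ^ n\<bar> \<le> (\<Sum>n<N. inv_sqrt_coeff n * \<bar>x\<bar> ^ n)"
    by (rule order_trans[OF sum_abs]) (simp add: abs_mult power_abs inv_sqrt_coeff_nonneg)
  also have "\<dots> \<le> 1 / sqrt (1 - \<bar>x\<bar>)"
    unfolding sums_unique[OF series]
    by (rule sum_le_suminf[OF sums_summable[OF series]]) (auto simp: inv_sqrt_coeff_nonneg)
  finally show ?thesis .
qed

lemma corner_weight_eq:
  assumes "0 < a" "a < 1"
  shows "corner_weight a = 1 / sqrt (a * (1 - a))"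
proof -
  have "t powr (-1/2) = 1 / sqrt t" if "t > 0" for t :: real
  proof -
    have "t powr (-1/2) = t powr (- (1/2))" by simp
    also have "\<dots> = inverse (t powr (1/2))" by (rule powr_minus)
    also have "\<dots> = 1 / sqrt t" using that by (simp add: powr_half_sqrt inverse_eq_divide)
    finally show ?thesis .
  qed
  then show ?thesis using assms unfolding corner_weight_def by (simp add: real_sqrt_mult)
qed

lemma partial_series_symbol_le:
  assumes "z \<in> {0<..<1} \<times> {0<..<1}"
  shows "\<bar>symbol z\<bar> < 1"
    and "\<bar>\<Sum>n<N. inv_sqrt_coeff n * symbol z ^ n\<bar> \<le> corner_weight (fst z) * corner_weight (snd z)"
proof -
  obtain b a where z: "z = (b, a)" and ab: "0 < a" "a < 1" "0 < b" "b < 1" using assms by auto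
  let ?c = "a * (1 - a) * (b * (1 - b))"
  have c: "0 < ?c" using ab by simp
  have le: "?c \<le> 1 - \<bar>symbol z\<bar>"
    unfolding z by (rule one_minus_abs_symbol_ge) (fact ab)+
  show lt: "\<bar>symbol z\<bar> < 1" using c le by linarith
  have "\<bar>\<Sum>n<N. inv_sqrt_coeff n * symbol z ^ n\<bar> \<le> 1 / sqrt (1 - \<bar>symbol z\<bar>)"
    by (rule partial_series_le[OF lt])
  also have "\<dots> \<le> 1 / sqrt ?c"
    using le c lt by (intro divide_left_mono real_sqrt_le_mono mult_pos_pos) auto
  also have "\<dots> = corner_weight (fst z) * corner_weight (snd z)"
    using ab by (simp add: z corner_weight_eq real_sqrt_mult)
  finally show "\<bar>\<Sum>n<N. inv_sqrt_coeff n * symbol z ^ n\<bar> \<le> corner_weight (fst z) * corner_weight (snd z)" .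
qed

definition square_weight :: "real \<times> real \<Rightarrow> real" where
  "square_weight z = (indicator {0..1} (fst z) * corner_weight (fst z)) * (indicator {0..1} (snd z) * corner_weight (snd z))"

lemma square_weight_integrable: "integrable (lborel \<Otimes>\<^sub>M lborel) square_weight"
proof (rule lborel_pair.Fubini_integrable)
  let ?k = "\<lambda>a. indicator {0..1} a * corner_weight a"
  note k = corner_weight_integrable
  have m: "?k \<in> borel_measurable borel"
    using borel_measurable_integrable[OF k] by simp
  show "square_weight \<in> borel_measurable (lborel \<Otimes>\<^sub>M lborel)"
    unfolding square_weight_def[abs_def]
    by (intro borel_measurable_times measurable_compose[OF _ m]) measurable
  have "norm (square_weight (x, y)) = norm (?k x) * norm (?k y)" for x y
    by (simp add: square_weight_def abs_mult)
  then show "integrable lborel (\<lambda>x. LBINT y. norm (square_weight (x, y)))"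
    using integrable_norm[OF k] by simp
  show "AE x in lborel. integrable lborel (\<lambda>y. square_weight (x, y))"
    unfolding square_weight_def fst_conv snd_conv
    by (intro AE_I2 integrable_mult_right k)
qed

text \<open>The Fourier transform of \<open>(1 - P)\<^sup>-\<^sup>1\<^sup>/\<^sup>2\<close>, with \<open>P\<close> the transition operator of the walk, is
  expanded in powers of the symbol of \<open>P\<close> and integrated term by term.\<close>

lemma walk_series_integral:
  "(\<lambda>n. complex_of_real (inv_sqrt_coeff n * walk n m)) sums
     square_integral (\<lambda>z. character m z / of_real (sqrt (1 - symbol z)))"
  and square_integrable_inv_sqrt:
  "square_integrable (\<lambda>z. character m z / of_real (sqrt (1 - symbol z)))"
proof -
  let ?M = "lborel \<Otimes>\<^sub>M lborel :: (real \<times> real) measure"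
  let ?Q = "{0..1::real} \<times> {0..1::real}"
  define p where "p N z = complex_of_real (\<Sum>n<N. inv_sqrt_coeff n * symbol z ^ n) * character m z" for N z
  let ?h = "\<lambda>z. character m z / of_real (sqrt (1 - symbol z))"
  have lim: "(\<lambda>N. p N z) \<longlonglongrightarrow> ?h z" if z: "z \<in> {0<..<1} \<times> {0<..<1}" for z
  proof -
    have "(\<lambda>N. \<Sum>n<N. inv_sqrt_coeff n * symbol z ^ n) \<longlonglongrightarrow> 1 / sqrt (1 - symbol z)"
      using inv_sqrt_coeff_series[OF partial_series_symbol_le(1)[OF z]] by (simp add: sums_def)
    then have "(\<lambda>N. p N z) \<longlonglongrightarrow> of_real (1 / sqrt (1 - symbol z)) * character m z"
      unfolding p_def by (intro tendsto_intros)
    then show ?thesis by simp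
  qed
  have bound: "cmod (p N z) \<le> square_weight z" if z: "z \<in> {0<..<1} \<times> {0<..<1}" for N z
  proof -
    have "cmod (p N z) = \<bar>\<Sum>n<N. inv_sqrt_coeff n * symbol z ^ n\<bar>"
      unfolding p_def by (simp only: norm_mult norm_of_real norm_character)
    also have "\<dots> \<le> square_weight z"
      using partial_series_symbol_le(2)[OF z] z by (auto simp: square_weight_def)
    finally show ?thesis .
  qed
  have weight_nonneg: "0 \<le> square_weight z" for z
    by (simp add: square_weight_def corner_weight_def)
  have meas_h: "(\<lambda>z. indicator ?Q z *\<^sub>R ?h z) \<in> borel_measurable ?M" by measurable
  have meas_p: "(\<lambda>z. indicator ?Q z *\<^sub>R p N z) \<in> borel_measurable ?M" for N
    unfolding p_def by measurable
  have AE_lim: "AE z in ?M. (\<lambda>N. indicator ?Q z *\<^sub>R p N z) \<longlonglongrightarrow> indicator ?Q z *\<^sub>R ?h z"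
    using open_square_AE by eventually_elim (auto simp: indicator_def intro!: lim)
  have AE_bound: "AE z in ?M. norm (indicator ?Q z *\<^sub>R p N z) \<le> square_weight z" for N
    using open_square_AE
    by eventually_elim (auto simp: indicator_def intro!: bound weight_nonneg)
  show "square_integrable ?h"
    unfolding set_integrable_def
    by (rule integrable_dominated_convergence[OF meas_h meas_p square_weight_integrable AE_lim AE_bound])
  have "(\<lambda>N. square_integral (p N)) \<longlonglongrightarrow> square_integral ?h"
    unfolding square_integral_def set_lebesgue_integral_def
    by (rule integral_dominated_convergence[OF meas_h meas_p square_weight_integrable AE_lim AE_bound])
  moreover have "square_integral (p N) = (\<Sum>n<N. complex_of_real (inv_sqrt_coeff n * walk n m))" for N
  proof -
    let ?t = "\<lambda>n z. indicator ?Q z *\<^sub>R (of_real (symbol z ^ n) * character m z)"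
    have t: "integrable ?M (?t n)" for n
      using symbol_character_integrable[of n m] by (simp add: set_integrable_def)
    have "square_integral (p N) = (\<integral>z. (\<Sum>n<N. of_real (inv_sqrt_coeff n) * ?t n z) \<partial>?M)"
      unfolding square_integral_def set_lebesgue_integral_def p_def
      by (rule Bochner_Integration.integral_cong) (auto simp: sum_distrib_left sum_distrib_right indicator_def mult_ac)
    also have "\<dots> = (\<Sum>n<N. \<integral>z. of_real (inv_sqrt_coeff n) * ?t n z \<partial>?M)"
      by (rule Bochner_Integration.integral_sum) (intro integrable_mult_right t)
    also have "\<dots> = (\<Sum>n<N. of_real (inv_sqrt_coeff n) * square_integral (\<lambda>z. of_real (symbol z ^ n) * character m z))"
      unfolding square_integral_def set_lebesgue_integral_def by (simp only: integral_mult_right_zero)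
    finally show ?thesis unfolding walk_eq_integral by simp
  qed
  ultimately show "(\<lambda>n. complex_of_real (inv_sqrt_coeff n * walk n m)) sums square_integral ?h"
    by (simp add: sums_def)
qed

lemma f_tilde_eq: "f_tilde m = square_integral (\<lambda>z. character m z / of_real (sqrt (1 - symbol z))) / of_real (sqrt 6)"
proof -
  obtain j k where m: "m = (j, k)" by force
  have symbol: "2 * (3 - cos (2 * pi * a) - cos (2 * pi * b) - cos (2 * pi * (a - b))) = 6 * (1 - symbol (b, a))" for a b
    by (simp add: symbol_def field_simps)
  have root: "sqrt (2 * (3 - cos (2 * pi * a) - cos (2 * pi * b) - cos (2 * pi * (a - b))))
      = sqrt 6 * sqrt (1 - symbol (b, a))" for a b
    unfolding symbol by (rule real_sqrt_mult)
  have "f_tilde m = (LBINT b:{0..1}. (LBINT a:{0..1}.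
      character m (b, a) / of_real (sqrt (1 - symbol (b, a))) / of_real (sqrt 6)))"
    unfolding m f_tilde.simps root by (simp add: character_def mult_ac)
  also have "\<dots> = (LBINT b:{0..1}. (LBINT a:{0..1}. character m (b, a) / of_real (sqrt (1 - symbol (b, a))))) / of_real (sqrt 6)"
    unfolding set_integral_divide_zero ..
  finally show ?thesis
    unfolding square_integral_iterated[OF square_integrable_inv_sqrt] .
qed

lemma f_tilde_walk_series:
  "\<exists>f :: int \<times> int \<Rightarrow> real. \<forall>m. f_tilde m = of_real (f m) \<and>
     (\<lambda>n. inv_sqrt_coeff n * walk n m) sums (sqrt 6 * f m)"
proof -
  define f where "f m = Re (f_tilde m)" for m
  have s: "(\<lambda>n. complex_of_real (inv_sqrt_coeff n * walk n m)) sums (of_real (sqrt 6) * f_tilde m)" for m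
    using walk_series_integral[of m] by (simp add: f_tilde_eq)
  have re: "(\<lambda>n. inv_sqrt_coeff n * walk n m) sums (sqrt 6 * f m)" for m
    using sums_Re[OF s[of m]] by (simp add: f_def)
  have "of_real (sqrt 6) * f_tilde m = of_real (sqrt 6) * of_real (f m)" for m
    using sums_unique2[OF s sums_of_real[OF re[of m]]] by simp
  then have "f_tilde m = of_real (f m)" for m by simp
  then show ?thesis using re by blast
qed

section \<open>The translates of the alternating function\<close>

text \<open>Going once around the hexagon from \<open>edge1 0\<close>, each step to an adjacent edge flips the sign.\<close>

lemma alternating_hexagon_functions:
  assumes alt: "alternating_on_hexagon (0, 0) g" and \<psi>: "\<And>m. \<psi> m = lattice_translate g m"
  obtains s where "hexagon_functions s \<psi>"
proof -
  define s where "s = g (edge1 0)"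
  have hex: "edge0 n \<in> hexagon (0, 0) \<longleftrightarrow> n = (0,-1) \<or> n = (-1,0)"
    "edge1 n \<in> hexagon (0, 0) \<longleftrightarrow> n = 0 \<or> n = (0,-1)"
    "edge2 n \<in> hexagon (0, 0) \<longleftrightarrow> n = 0 \<or> n = (-1,0)" for n
    by (simp_all add: hexagon_def) (auto simp: edge_defs prod_eq_iff)
  have flip: "g y = - g x" if "x \<in> hexagon (0, 0)" "y \<in> hexagon (0, 0)" "x \<inter> y \<noteq> {}" "x \<noteq> y" for x y
  proof -
    have "edge_adj x y" using that by (simp add: edge_adj_def hexagon_def)
    then show ?thesis using alt that(1,2) unfolding alternating_on_hexagon_def by simp
  qed
  have sign: "s = 1 \<or> s = -1"
    using alt hex(2)[of 0] by (auto simp: alternating_on_hexagon_def s_def)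
  have outside: "g x = 0" if "x \<notin> hexagon (0, 0)" for x
    using alt that by (auto simp: alternating_on_hexagon_def)
  have a: "g (edge0 (-1,0)) = - s"
    unfolding s_def by (rule flip) (auto simp: hex edge_disjoint zero_prod_def)
  have b: "g (edge2 (-1,0)) = s"
    using flip[of "edge0 (-1,0)" "edge2 (-1,0)"] a by (simp add: hex edge_disjoint)
  have c: "g (edge1 (0,-1)) = - s"
    using flip[of "edge2 (-1,0)" "edge1 (0,-1)"] b by (simp add: hex edge_disjoint)
  have d: "g (edge0 (0,-1)) = s"
    using flip[of "edge1 (0,-1)" "edge0 (0,-1)"] c by (simp add: hex edge_disjoint)
  have e: "g (edge2 0) = - s"
    unfolding s_def by (rule flip) (auto simp: hex edge_disjoint)
  have translate: "shift (- fst m, - snd m) ` edge0 n = edge0 (n - m)"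
    "shift (- fst m, - snd m) ` edge1 n = edge1 (n - m)"
    "shift (- fst m, - snd m) ` edge2 n = edge2 (n - m)" for m n
    by (auto simp: edge_defs)
  have psi: "\<psi> m x = g (shift (- fst m, - snd m) ` x)" for m x
    unfolding \<psi> by (cases m) simp
  have "hexagon_functions s \<psi>"
  proof
    show "s = 1 \<or> s = -1" by (rule sign)
    fix m n x
    show "\<psi> m (edge0 n) = s * ((if m = n + (0,1) then 1 else 0) - (if m = n + (1,0) then 1 else 0))"
    proof -
      have "m = n + (0,1) \<longleftrightarrow> n - m = (0,-1)" "m = n + (1,0) \<longleftrightarrow> n - m = (-1,0)"
        by (auto simp: prod_eq_iff)
      then show ?thesis
        unfolding psi translate using a d outside[of "edge0 (n - m)"] by (auto simp: hex)
    qed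
    show "\<psi> m (edge1 n) = s * ((if m = n then 1 else 0) - (if m = n + (0,1) then 1 else 0))"
    proof -
      have "m = n \<longleftrightarrow> n - m = 0" "m = n + (0,1) \<longleftrightarrow> n - m = (0,-1)"
        by (auto simp: prod_eq_iff)
      then show ?thesis
        unfolding psi translate using c outside[of "edge1 (n - m)"] by (auto simp: hex s_def zero_prod_def)
    qed
    show "\<psi> m (edge2 n) = s * ((if m = n + (1,0) then 1 else 0) - (if m = n then 1 else 0))"
    proof -
      have "m = n \<longleftrightarrow> n - m = 0" "m = n + (1,0) \<longleftrightarrow> n - m = (-1,0)"
        by (auto simp: prod_eq_iff)
      then show ?thesis
        unfolding psi translate using b e outside[of "edge2 (n - m)"] by (auto simp: hex zero_prod_def)
    qed
    show "\<psi> m x = 0" if "x \<notin> \<Gamma>\<^sub>0"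
    proof -
      have "shift m ` (shift (- fst m, - snd m) ` x) = x" for x
      proof -
        have "shift m (shift (- fst m, - snd m) v) = v" for v by (cases m; cases v) auto
        then show ?thesis by (simp add: image_image)
      qed
      moreover have "shift m ` y \<in> \<Gamma>\<^sub>0" if "y \<in> \<Gamma>\<^sub>0" for y
      proof -
        have "shift m ` edge0 n = edge0 (n + m)" "shift m ` edge1 n = edge1 (n + m)"
          "shift m ` edge2 n = edge2 (n + m)" for n
          by (cases m; auto simp: edge_defs)+
        with that show ?thesis by (cases y rule: edge_cases) auto
      qed
      ultimately have "shift (- fst m, - snd m) ` x \<notin> \<Gamma>\<^sub>0" using that by metis
      then show ?thesis unfolding psi by (intro outside) (simp add: hexagon_def)
    qed
  qed
  then show thesis by (rule that)
qed

lemma tau_eq: "tau p f m = f (m + p)"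
  by (cases p; cases m) simp

theorem theorem5p7:
  fixes \<psi>\<^sub>0 :: "hex_vertex set \<Rightarrow> complex"
    and \<psi> :: "int \<times> int \<Rightarrow> hex_vertex set \<Rightarrow> complex"
  assumes "alternating_on_hexagon (0, 0) \<psi>\<^sub>0"
    and "\<And>jk. \<psi> jk = lattice_translate \<psi>\<^sub>0 jk"
  shows "ell2_orthonormal_basis \<Gamma>\<^sub>0 E6 (\<lambda>pq x. \<Sum>\<^sub>\<infinity>jk. tau pq f_tilde jk * \<psi> jk x) \<and>
    (\<forall>F\<in>ell2 \<Gamma>\<^sub>0. \<forall>x\<in>\<Gamma>\<^sub>0.
      ((\<lambda>pq. (\<Sum>\<^sub>\<infinity>y\<in>\<Gamma>\<^sub>0. (\<Sum>\<^sub>\<infinity>jk. tau pq f_tilde jk * \<psi> jk y * F y)) *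
             (\<Sum>\<^sub>\<infinity>jk'. tau pq f_tilde jk' * \<psi> jk' x))
        has_sum ell2_proj \<Gamma>\<^sub>0 E6 F x) UNIV)"
proof -
  obtain s where "hexagon_functions s \<psi>"
    by (rule alternating_hexagon_functions[OF assms])
  moreover obtain f where f: "\<And>m. f_tilde m = of_real (f m)"
    and series: "\<And>m. (\<lambda>n. inv_sqrt_coeff n * walk n m) sums (sqrt 6 * f m)"
    using f_tilde_walk_series by blast
  ultimately interpret walk_potential s \<psi> f
    by (simp add: walk_potential_def walk_potential_axioms_def)
  have basis: "(\<Sum>\<^sub>\<infinity>jk. tau pq f_tilde jk * \<psi> jk x) = basis pq x" for pq x
    by (simp add: basis_def curl_def tau_eq f)
  have coefficient: "(\<Sum>\<^sub>\<infinity>y\<in>\<Gamma>\<^sub>0. (\<Sum>\<^sub>\<infinity>jk. tau pq f_tilde jk * \<psi> jk y * F y)) = ell2_inner \<Gamma>\<^sub>0 F (basis pq)" for pq F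
    unfolding ell2_inner_def basis_real infsum_cmult_left' basis by (simp add: mult.commute)
  show ?thesis
    unfolding coefficient basis using basis_of_E6 by blast
qed

end
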